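(* Let $p$ be a prime, $m\in\mathbb{N}$ and $q=p^m$ with $q\ge 5$, $q\neq 9$, and assume $4\mid\frac{q-1}{p-1}$. Put $n=\frac{q-1}{4}$. Then the generalized Paley graph $\Gamma(4,q)$ is connected and all its eigenvalues are integers; more precisely: (a) If $p\equiv 1\pmod 4$, then $m=4t$ for some $t\in\mathbb{N}$. There exist integers $c,d$ with $$\sqrt q=c^2+4d^2,\qquad c\equiv 1\pmod 4,\qquad \gcd(c,p)=1$$ ($c$ is uniquely determined and $d$ is determined up to sign), and for any such $c,d$ the eigenvalues of $\Gamma(4,q)$, listed with multiplicity, are: $n$ with multiplicity $1$, and each of $$\tfrac{\sqrt q+4d\sqrt[4]{q}-1}{4},\quad \tfrac{\sqrt q-4d\sqrt[4]{q}-1}{4},\quad \tfrac{-\sqrt q+2c\sqrt[4]{q}-1}{4},\quad \tfrac{-\sqrt q-2c\sqrt[4]{q}-1}{4}$$ with multiplicity $n$. (b) If $p\equiv 3\pmod 4$, then $m=2t$ for some $t\in\mathbb{N}$, and the eigenvalues of $\Gamma(4,q)$, listed with multiplicity, are: if $m\equiv 0\pmod 4$, $n$ once, $\frac{\sqrt q-1}{4}$ with multiplicity $3n$ and $\frac{-3\sqrt q-1}{4}$ with multiplicity $n$; if $m\equiv 2\pmod 4$, $n$ once, $\frac{3\sqrt q-1}{4}$ with multiplicity $n$ and $\frac{-\sqrt q-1}{4}$ with multiplicity $3n$. In particular, in case (b), $\Gamma(4,q)$ is strongly regular.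
   Context: For a prime power $q$ and $k\mid q-1$, let $R_k=\{x^k : x\in\mathbb{F}_q^*\}$ be the set of nonzero $k$-th powers in $\mathbb{F}_q$. The generalized Paley graph $\Gamma(k,q)$ is the Cayley graph with vertex set $\mathbb{F}_q$ in which $v,w$ are adjacent iff $w-v\in R_k$. Its eigenvalues are those of its adjacency matrix. *)

theory Defs
  imports
    Complex_Main
    "HOL-Library.Cardinality"
    "HOL-Number_Theory.Cong"
    "Jordan_Normal_Form.Char_Poly"
    "Graph_Theory.Graph_Theory"
begin

definition power_residues :: "nat \<Rightarrow> 'a::field set" where
  "power_residues k = {x ^ k | x. x \<noteq> 0}"

definition gen_paley :: "nat \<Rightarrow> 'a::field pair_pre_digraph" where
  "gen_paley k = \<lparr>pverts = UNIV, parcs = {(v, w). w - v \<in> power_residues k}\<rparr>"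

text \<open>The list \<open>vs\<close> is the ordering of the vertices that indexes rows and columns.\<close>

definition adjacency_matrix :: "'a list \<Rightarrow> 'a pair_pre_digraph \<Rightarrow> complex mat" where
  "adjacency_matrix vs G =
     mat (length vs) (length vs) (\<lambda>(i, j). if (vs ! i, vs ! j) \<in> parcs G then 1 else 0)"

text \<open>All complex eigenvalues, each repeated according to its algebraic multiplicity.\<close>

definition graph_spectrum :: "'a list \<Rightarrow> 'a pair_pre_digraph \<Rightarrow> complex multiset" where
  "graph_spectrum vs G = proots (char_poly (adjacency_matrix vs G))"

definition common_neighbours :: "'a pair_pre_digraph \<Rightarrow> 'a \<Rightarrow> 'a \<Rightarrow> 'a set" where
  "common_neighbours G u v = {w \<in> pverts G. (u, w) \<in> parcs G \<and> (v, w) \<in> parcs G}"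

text \<open>
  The locale predicate \<open>pair_graph\<close> says that \<open>G\<close> is a finite simple undirected graph,
  encoded as a symmetric loop-free arc relation.  Complete and edgeless graphs are
  not counted as strongly regular.
\<close>

definition strongly_regular :: "'a pair_pre_digraph \<Rightarrow> bool" where
  "strongly_regular G \<longleftrightarrow>
     pair_graph G \<and>
     parcs G \<noteq> {} \<and>
     (\<exists>u\<in>pverts G. \<exists>v\<in>pverts G. u \<noteq> v \<and> (u, v) \<notin> parcs G) \<and>
     (\<exists>k e f.
        (\<forall>v\<in>pverts G. out_degree (with_proj G) v = k) \<and>
        (\<forall>u\<in>pverts G. \<forall>v\<in>pverts G. (u, v) \<in> parcs G
           \<longrightarrow> card (common_neighbours G u v) = e) \<and>
        (\<forall>u\<in>pverts G. \<forall>v\<in>pverts G. u \<noteq> v \<and> (u, v) \<notin> parcs G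
           \<longrightarrow> card (common_neighbours G u v) = f))"

definition paley4_rep :: "nat \<Rightarrow> nat \<Rightarrow> int \<Rightarrow> int \<Rightarrow> bool" where
  "paley4_rep p q c d \<longleftrightarrow>
     sqrt (real q) = real_of_int (c\<^sup>2 + 4 * d\<^sup>2) \<and> [c = 1] (mod 4) \<and> gcd c (int p) = 1"

end

theory Submission
  imports Defs
begin

text \<open>
  The matrix \<open>(\<psi> (v w))\<close> of a nontrivial additive character \<open>\<psi>\<close> diagonalises the adjacency matrix,
  so the eigenvalues are \<open>n\<close> and the quartic Gaussian periods \<open>\<eta>\<^sub>0, \<dots>, \<eta>\<^sub>3\<close>, each with
  multiplicity \<open>n\<close>.  The hypothesis \<open>4 dvd (q - 1) div (p - 1)\<close> makes every element of the prime
  field a fourth power, which forces the periods to be integers.  The quadratic Gauss sum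
  \<open>A = \<eta>\<^sub>0 + \<eta>\<^sub>2 - \<eta>\<^sub>1 - \<eta>\<^sub>3\<close> satisfies \<open>A\<^sup>2 = q\<close>, and the quartic one is \<open>G = P + \<i> Q\<close> with
  \<open>P = \<eta>\<^sub>0 - \<eta>\<^sub>2\<close>, \<open>Q = \<eta>\<^sub>1 - \<eta>\<^sub>3\<close> and \<open>P\<^sup>2 + Q\<^sup>2 = q\<close>.  Changing \<open>\<psi>\<close> shifts the periods cyclically,
  so one may assume \<open>A \<equiv> 3\<close> modulo \<open>4\<close>; since \<open>2 (\<eta>\<^sub>1 + \<eta>\<^sub>3) = - 1 - A\<close>, this makes \<open>Q\<close> even.

  If \<open>p \<equiv> 3\<close> modulo \<open>4\<close>, a sum of two squares equal to \<open>p ^ (2 k)\<close> is trivial, whence \<open>Q = 0\<close>.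
  If \<open>p \<equiv> 1\<close> modulo \<open>4\<close> and \<open>m = 4 t\<close>, then \<open>G\<^sup>2 = A J\<close> for the Jacobi sum \<open>J\<close>, which is not
  divisible by \<open>p\<close> because a binomial coefficient is not; hence \<open>p ^ t\<close> is the exact power of \<open>p\<close>
  dividing \<open>G\<close>, and \<open>G / p ^ t\<close> yields \<open>c\<close> and \<open>d\<close>.  They are unique because a primitive
  representation of a prime power as a sum of two squares is.
\<close>

section \<open>Congruences and power sums\<close>

text \<open>Induction on \<open>a\<close> shows that \<open>a ^ p\<close> is congruent to
  \<open>a\<close>, because the inner binomial coefficients in \<open>(a + 1) ^ p\<close> are
  divisible by \<open>p\<close>; then \<open>a\<close> is cancelled.\<close>

lemma fermat_little:
  assumes p: "prime (p::nat)" and a: "\<not> p dvd a"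
  shows "[a ^ (p - 1) = 1] (mod p)"
proof -
  have p0: "p > 0" using p by (rule prime_gt_0_nat)
  have "[a ^ p = a] (mod p)"
  proof (induction a)
    case 0
    then show ?case using p0 by (simp add: power_0_left)
  next
    case (Suc a)
    have "Suc a ^ p = (\<Sum>k\<le>p. (p choose k) * a ^ k)"
      using binomial[of a 1 p] by simp
    also have "\<dots> = (\<Sum>k\<in>{..p} - {0, p}. (p choose k) * a ^ k) + (\<Sum>k\<in>{0, p}. (p choose k) * a ^ k)"
      by (rule sum.subset_diff) auto
    also have "(\<Sum>k\<in>{0, p}. (p choose k) * a ^ k) = 1 + a ^ p" using p0 by simp
    finally have eq: "Suc a ^ p = (\<Sum>k\<in>{..p} - {0, p}. (p choose k) * a ^ k) + (1 + a ^ p)" .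
    have "p dvd (\<Sum>k\<in>{..p} - {0, p}. (p choose k) * a ^ k)"
      by (intro dvd_sum dvd_mult2 dvd_choose_prime) (use p in auto)
    then have "[(\<Sum>k\<in>{..p} - {0, p}. (p choose k) * a ^ k) = 0] (mod p)"
      by (simp add: cong_0_iff)
    then have "[Suc a ^ p = 0 + (1 + a)] (mod p)"
      unfolding eq by (intro cong_add Suc.IH cong_refl)
    then show ?case by simp
  qed
  moreover have "a ^ p = a * a ^ (p - 1)" using p0 by (simp flip: power_Suc)
  ultimately have "[a * a ^ (p - 1) = a * 1] (mod p)" by simp
  moreover have "coprime a p"
    using p a by (metis coprime_commute prime_imp_coprime_nat)
  ultimately show ?thesis by (simp only: cong_mult_lcancel_nat)
qed

lemma card_power_roots_le:
  fixes c :: "'a::field"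
  assumes "k > 0"
  shows "card {x. x ^ k = c} \<le> k"
proof -
  let ?f = "monom 1 k - [:c:]"
  have "coeff ?f k = 1"
    using assms by (simp add: coeff_pCons split: nat.splits)
  then have "?f \<noteq> 0"
    by (metis coeff_0 zero_neq_one)
  then have "card {x. poly ?f x = 0} \<le> degree ?f"
    by (rule card_poly_roots_bound)
  moreover have "degree ?f \<le> k"
    by (intro degree_diff_le degree_monom_le) auto
  moreover have "{x. poly ?f x = 0} = {x. x ^ k = c}"
    by (simp add: poly_monom)
  ultimately show ?thesis by simp
qed

text \<open>Translation by 1 permutes the ring, so it leaves the sum of all elements unchanged, yet
  it adds \<open>CARD('a)\<close> ones.\<close>

lemma of_nat_card_UNIV_eq_0: "of_nat (CARD('a)) = (0 :: 'a::{ring_1,finite})"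
proof -
  have "(\<Sum>x\<in>UNIV. x + 1 :: 'a) = (\<Sum>x\<in>UNIV. x)"
    by (rule sum.reindex_bij_witness[of _ "\<lambda>x. x - 1" "\<lambda>x. x + 1"]) auto
  then show ?thesis
    by (simp add: sum.distrib)
qed

lemma card_units: "card (UNIV - {0 :: 'a::{zero,finite}}) = CARD('a) - 1"
  by (simp add: card_Diff_singleton)

lemma power_card_minus_1:
  fixes x :: "'a::{field,finite}"
  assumes "x \<noteq> 0"
  shows "x ^ (CARD('a) - 1) = 1"
proof -
  have "(\<Prod>y\<in>UNIV-{0}. x * y) = x ^ (CARD('a) - 1) * \<Prod>(UNIV-{0})"
    by (simp add: prod.distrib card_units)
  moreover have "(\<Prod>y\<in>UNIV-{0}. x * y) = \<Prod>(UNIV-{0})"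
    by (rule prod.reindex_bij_witness[of _ "\<lambda>y. y / x" "\<lambda>y. x * y"]) (use assms in auto)
  ultimately show ?thesis by simp
qed

text \<open>Replacing \<open>x\<close> by \<open>y * x\<close> multiplies the sum by
  \<open>y ^ e\<close>, so one unit \<open>y\<close> with \<open>y ^ e \<noteq> 1\<close> suffices.
  For \<open>e = 0\<close> the sum counts the whole field, because \<open>0 ^ 0 = 1\<close>.\<close>

lemma sum_power_units:
  fixes e :: nat
  assumes "e = 0 \<or> \<not> (CARD('a) - 1) dvd e"
  shows "(\<Sum>x\<in>UNIV. x ^ e) = (0 :: 'a::{field,finite})"
proof (cases "e = 0")
  case True
  then show ?thesis by (simp add: of_nat_card_UNIV_eq_0)
next
  case False
  let ?N = "CARD('a) - 1"
  have "card {0, 1 :: 'a} \<le> CARD('a)"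
    by (rule card_mono) auto
  then have N: "?N > 0" by simp
  \<comment> \<open>The reduced exponent is below the number of units, so \<open>y ^ r = 1\<close>
    cannot hold for all of them.\<close>
  define r where "r = e mod ?N"
  have r: "0 < r" "r < ?N"
    using assms False N by (auto simp: r_def dvd_eq_mod_eq_0)
  have "\<not> UNIV - {0 :: 'a} \<subseteq> {y. y ^ r = 1}"
  proof
    assume "UNIV - {0 :: 'a} \<subseteq> {y. y ^ r = 1}"
    then have "?N \<le> card {y :: 'a. y ^ r = 1}"
      by (metis card_units card_mono finite)
    also have "\<dots> \<le> r" by (rule card_power_roots_le) (use r in simp)
    finally show False using r by simp
  qed
  then obtain y :: 'a where y: "y \<noteq> 0" "y ^ r \<noteq> 1" by auto
  have "y ^ e = y ^ (?N * (e div ?N) + r)" by (simp add: r_def)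
  also have "\<dots> = y ^ r"
    by (simp only: power_add power_mult power_card_minus_1[OF y(1)]) simp
  finally have ye: "y ^ e \<noteq> 1" using y by simp
  have "(\<Sum>x\<in>UNIV. x ^ e) = (\<Sum>x\<in>UNIV. (y * x) ^ e)"
    by (rule sum.reindex_bij_witness[of _ "\<lambda>x. y * x" "\<lambda>x. x / y"]) (use y in auto)
  also have "\<dots> = y ^ e * (\<Sum>x\<in>UNIV. x ^ e)"
    by (simp add: power_mult_distrib sum_distrib_left)
  finally have "(1 - y ^ e) * (\<Sum>x\<in>UNIV. x ^ e) = 0" by (simp add: algebra_simps)
  with ye show ?thesis by simp
qed

lemma sum_power_card_minus_1:
  "(\<Sum>x\<in>UNIV. x ^ (CARD('a) - 1)) = (- 1 :: 'a::{field,finite})"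
proof -
  have "card {0, 1 :: 'a} \<le> CARD('a)"
    by (rule card_mono) auto
  then have N: "CARD('a) - 1 > 0" by simp
  have "(\<Sum>x\<in>UNIV. x ^ (CARD('a) - 1)) = (\<Sum>x\<in>UNIV-{0}. x ^ (CARD('a) - 1) :: 'a)"
    using N by (intro sum.mono_neutral_right) auto
  also have "\<dots> = (\<Sum>x\<in>UNIV-{0::'a}. 1)"
    by (intro sum.cong refl power_card_minus_1) auto
  also have "\<dots> = of_nat (CARD('a) - 1)" by (simp add: card_units)
  also have "\<dots> = of_nat CARD('a) - 1" using N by (subst of_nat_diff) auto
  finally show ?thesis by (simp add: of_nat_card_UNIV_eq_0)
qed

section \<open>Powers of a prime in factorials\<close>

lemma multiplicity_fact_add:
  assumes "prime (p::nat)" "b < p"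
  shows "multiplicity p (fact (p * a + b) :: nat) = multiplicity p (fact (p * a) :: nat)"
  using assms(2)
proof (induction b)
  case (Suc b)
  have "\<not> p dvd p * a + Suc b"
    using Suc.prems by (metis dvd_add_right_iff dvd_triv_left nat_dvd_not_less zero_less_Suc)
  then have "multiplicity p (p * a + Suc b) = 0"
    by (rule not_dvd_imp_multiplicity_0)
  moreover have "fact (p * a + Suc b) = (p * a + Suc b) * (fact (p * a + b) :: nat)"
    by simp
  ultimately show ?case
    using Suc assms(1) prime_elem_multiplicity_mult_distrib[of p "p * a + Suc b" "fact (p * a + b)"]
    by simp
qed simp

text \<open>One step of Legendre's formula: the multiples of \<open>p\<close> among the factors are
  \<open>p\<close>, \<open>2 p\<close>, ..., \<open>a p\<close>, and dividing each of them by
  \<open>p\<close> leaves the factors of \<open>fact a\<close>.\<close>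

lemma multiplicity_fact_mult_add:
  assumes p: "prime (p::nat)" and "b < p"
  shows "multiplicity p (fact (p * a + b) :: nat) = a + multiplicity p (fact a :: nat)"
proof -
  have "multiplicity p (fact (p * a) :: nat) = a + multiplicity p (fact a :: nat)"
  proof (induction a)
    case (Suc a)
    obtain r where r: "p = Suc r" using p by (cases p) auto
    have eq: "p * Suc a = Suc (p * a + r)" using r by simp
    have "(fact (p * Suc a) :: nat) = (p * Suc a) * fact (p * a + r)"
      by (subst (1 2) eq) (simp only: fact_Suc of_nat_id)
    moreover have "multiplicity p (fact (p * a + r) :: nat) = multiplicity p (fact (p * a) :: nat)"
      by (rule multiplicity_fact_add) (use p r in auto)
    moreover have "multiplicity p p = 1" using p by (simp add: prime_nat_iff)
    moreover have "p > 0" using p by (simp add: prime_gt_0_nat)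
    moreover have "(fact (Suc a) :: nat) = Suc a * fact a" by simp
    ultimately show ?case
      using Suc p by (simp add: prime_elem_multiplicity_mult_distrib del: fact_Suc mult_Suc_right mult_Suc)
  qed simp
  then show ?thesis by (simp add: multiplicity_fact_add[OF assms])
qed

text \<open>All base-\<open>p\<close> digits of \<open>n\<close> equal \<open>(p - 1) / 4\<close>, so \<open>n + 2 n\<close> involves no carries.\<close>

lemma prime_not_dvd_choose_three:
  assumes p: "prime (p::nat)" and p4: "p = 4 * r + 1" and n: "4 * n + 1 = p ^ m"
  shows "\<not> p dvd (3 * n) choose n"
proof -
  \<comment> \<open>The induction appends the digit \<open>r\<close>, turning \<open>n\<close> into
    \<open>p * n + r\<close>, and carries the valuation identity along.\<close>
  have key: "\<exists>n. 4 * n + 1 = p ^ m \<and>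
      multiplicity p (fact (3 * n) :: nat) =
      multiplicity p (fact n :: nat) + multiplicity p (fact (2 * n) :: nat)"
  proof (induction m)
    case (Suc m)
    then obtain n where n: "4 * n + 1 = p ^ m" and
      IH: "multiplicity p (fact (3 * n) :: nat) =
           multiplicity p (fact n :: nat) + multiplicity p (fact (2 * n) :: nat)" by blast
    have "4 * (p * n + r) + 1 = p * (4 * n + 1)" by (simp add: p4 algebra_simps)
    also have "\<dots> = p ^ Suc m" by (simp only: n power_Suc)
    finally have n': "4 * (p * n + r) + 1 = p ^ Suc m" .
    \<comment> \<open>Since \<open>3 * r < p\<close>, multiplying by \<open>k\<close> creates no
      carry: the last digit of the product is \<open>k * r\<close>.\<close>
    have step: "multiplicity p (fact (k * (p * n + r)) :: nat) =
        k * n + multiplicity p (fact (k * n) :: nat)" if "k \<le> 3" for k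
    proof -
      have "k * r \<le> 3 * r" using that by simp
      then have "k * r < p" using p4 by linarith
      then show ?thesis
        using multiplicity_fact_mult_add[OF p, of "k * r" "k * n"]
        by (simp add: algebra_simps)
    qed
    show ?case
      using n' IH step[of 1] step[of 2] step[of 3]
      by (intro exI[of _ "p * n + r"]) simp
  qed auto
  then obtain n' where n': "4 * n' + 1 = p ^ m" and
    mult': "multiplicity p (fact (3 * n') :: nat) =
      multiplicity p (fact n' :: nat) + multiplicity p (fact (2 * n') :: nat)" by blast
  have "n' = n" using n n' by linarith
  with mult' have mult: "multiplicity p (fact (3 * n) :: nat) =
      multiplicity p (fact n :: nat) + multiplicity p (fact (2 * n) :: nat)"
    by simp
  have "fact n * fact (2 * n) * ((3 * n) choose n) = (fact (3 * n) :: nat)"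
    using binomial_fact_lemma[of n "3 * n"] by simp
  moreover have "(3 * n) choose n \<noteq> 0" by simp
  ultimately have "multiplicity p ((3 * n) choose n) = 0"
    using p mult
    by (metis add_cancel_right_right fact_nonzero mult_eq_0_iff prime_elem_multiplicity_mult_distrib
        prime_imp_prime_elem)
  then show ?thesis
    using \<open>(3 * n) choose n \<noteq> 0\<close> p by (metis multiplicity_eq_zero_iff not_prime_unit)
qed

section \<open>The trace and an additive character\<close>

text \<open>The functional is the absolute trace \<open>x + x ^ p + ... + x ^ (p ^ (m - 1))\<close>,
  with its values in the prime field read as naturals below \<open>p\<close>. It is not identically
  zero because its polynomial has degree below \<open>CARD('a)\<close>.\<close>

lemma ex_trace_functional:
  assumes p: "prime p" and card: "CARD('a::{field,finite}) = p ^ m"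
  shows "\<exists>T :: 'a \<Rightarrow> nat. (\<forall>x. T x < p) \<and> (\<forall>x y. T (x + y) = (T x + T y) mod p) \<and> (\<exists>x. T x \<noteq> 0)"
proof -
  have "card {0, 1 :: 'a} \<le> CARD('a)"
    by (rule card_mono) auto
  then have m: "m > 0" using card by (cases m) auto
  have "of_nat (p ^ m) = (0 :: 'a)"
    using of_nat_card_UNIV_eq_0[where 'a = 'a] card by simp
  then have p0: "of_nat p = (0 :: 'a)" by simp
  then have "CHAR('a) dvd p" by (simp add: of_nat_eq_0_iff_char_dvd)
  moreover have "CHAR('a) \<noteq> 1" by (metis of_nat_CHAR of_nat_1 zero_neq_one)
  ultimately have char: "CHAR('a) = p"
    using p by (metis prime_nat_iff)
  have pc: "prime CHAR('a)" using p char by simp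
  define tr where "tr = (\<lambda>x :: 'a. \<Sum>i<m. x ^ (p ^ i))"
  have tr_add: "tr (x + y) = tr x + tr y" for x y
  proof -
    have "(x + y) ^ (p ^ i) = x ^ (p ^ i) + y ^ (p ^ i)" for i
      by (rule freshmans_dream'[OF pc, where n = i]) (simp add: char)
    then show ?thesis by (simp add: tr_def sum.distrib)
  qed
  have x_pm: "x ^ (p ^ m) = x" for x :: 'a
  proof (cases "x = 0")
    case False
    have "p ^ m = Suc (CARD('a) - 1)" using card p by (simp add: prime_gt_0_nat)
    then show ?thesis using power_card_minus_1[OF False] by (simp only: power_Suc) simp
  qed (use p in \<open>simp add: prime_gt_0_nat\<close>)
  \<comment> \<open>Frobenius permutes the summands cyclically, since
    \<open>x ^ (p ^ m) = x\<close>.\<close>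
  have tr_p: "tr x ^ p = tr x" for x
  proof -
    have "tr x ^ p = (\<Sum>i<m. (x ^ (p ^ i)) ^ p)"
      unfolding tr_def by (rule freshmans_dream_sum[OF pc]) (simp add: char)
    also have "\<dots> = (\<Sum>i<m. x ^ (p ^ Suc i))"
      by (intro sum.cong refl) (simp add: mult.commute flip: power_mult)
    also have "\<dots> = (\<Sum>i<Suc m. x ^ (p ^ i)) - x"
      by (subst sum.lessThan_Suc_shift) simp
    also have "\<dots> = tr x" by (simp add: tr_def x_pm)
    finally show ?thesis .
  qed
  have inj: "inj_on (of_nat :: nat \<Rightarrow> 'a) {..<p}"
    by (auto simp: inj_on_def of_nat_eq_iff_cong_CHAR char cong_def)
  \<comment> \<open>The \<open>p\<close> elements of the prime field are roots of
    \<open>y ^ p - y\<close>, whose degree leaves no room for others.\<close>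
  have range: "{y :: 'a. y ^ p = y} = of_nat ` {..<p}"
  proof (rule sym, rule card_seteq)
    have "of_nat k ^ p = (of_nat k :: 'a)" for k
    proof (induction k)
      case (Suc k)
      then show ?case using freshmans_dream[OF pc, of p 1 "of_nat k"] char by simp
    qed (use p in \<open>simp add: prime_gt_0_nat\<close>)
    then show "of_nat ` {..<p} \<subseteq> {y :: 'a. y ^ p = y}" by auto
    let ?f = "monom 1 p - [:0, 1 :: 'a:]"
    have "coeff ?f p = 1"
      using prime_gt_1_nat[OF p] by (auto simp: coeff_pCons split: nat.splits)
    then have "?f \<noteq> 0" by (metis coeff_0 zero_neq_one)
    then have "card {x. poly ?f x = 0} \<le> degree ?f" by (rule card_poly_roots_bound)
    moreover have "degree ?f \<le> p"
      using prime_gt_1_nat[OF p] by (intro degree_diff_le degree_monom_le) auto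
    moreover have "{x. poly ?f x = 0} = {y :: 'a. y ^ p = y}"
      by (simp add: poly_monom)
    ultimately show "card {y :: 'a. y ^ p = y} \<le> card (of_nat ` {..<p} :: 'a set)"
      using inj by (simp add: card_image)
  qed simp
  have "\<exists>x. tr x \<noteq> 0"
  proof (rule ccontr)
    assume "\<not> ?thesis"
    then have all0: "tr x = 0" for x by auto
    let ?f = "\<Sum>i<m. monom (1 :: 'a) (p ^ i)"
    have "coeff ?f 1 = (\<Sum>i<m. if i = 0 then 1 else 0)"
      unfolding coeff_sum using prime_gt_1_nat[OF p]
      by (intro sum.cong refl) (auto simp: coeff_monom)
    also have "\<dots> = 1" using m by simp
    finally have "?f \<noteq> 0" by (metis coeff_0 zero_neq_one)
    then have "card {x. poly ?f x = 0} \<le> degree ?f" by (rule card_poly_roots_bound)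
    moreover have "{x. poly ?f x = 0} = UNIV"
      using all0 by (auto simp: poly_sum poly_monom tr_def)
    moreover have "degree ?f \<le> p ^ (m - 1)"
    proof (rule degree_sum_le)
      fix i assume "i \<in> {..<m}"
      then have "i \<le> m - 1" by auto
      then have "p ^ i \<le> p ^ (m - 1)"
        using prime_gt_0_nat[OF p] by (intro power_increasing) auto
      then show "degree (monom (1 :: 'a) (p ^ i)) \<le> p ^ (m - 1)"
        using degree_monom_le order_trans by blast
    qed simp
    ultimately have "p ^ m \<le> p ^ (m - 1)" using card by simp
    then show False using prime_gt_1_nat[OF p] m by simp
  qed
  then obtain x0 where x0: "tr x0 \<noteq> 0" by blast
  have "\<forall>x. \<exists>k<p. tr x = of_nat k"
    using tr_p range by (metis (mono_tags, lifting) imageE lessThan_iff mem_Collect_eq)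
  then obtain T where T: "\<And>x. T x < p" "\<And>x. tr x = of_nat (T x)"
    by metis
  have "T (x + y) = (T x + T y) mod p" for x y
  proof -
    have "of_nat (T (x + y)) = (of_nat (T x + T y) :: 'a)"
      using tr_add[of x y] T by simp
    then have "[T (x + y) = T x + T y] (mod p)"
      by (simp only: of_nat_eq_iff_cong_CHAR char)
    then show ?thesis using T(1)[of "x + y"] by (simp add: cong_def)
  qed
  moreover have "T x0 \<noteq> 0" using x0 T(2)[of x0] by (cases "T x0 = 0") auto
  ultimately show ?thesis using T(1) by blast
qed

text \<open>
  The sums over \<open>C\<close> are integers because the nonzero values of the trace are all taken equally
  often on \<open>C\<close>.
\<close>

lemma ex_additive_character:
  assumes p: "prime p" and card: "CARD('a::{field,finite}) = p ^ m"
  shows "\<exists>\<psi> :: 'a \<Rightarrow> complex. (\<forall>x y. \<psi> (x + y) = \<psi> x * \<psi> y) \<and> \<psi> 0 = 1 \<and> (\<exists>x. \<psi> x \<noteq> 1) \<and>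
    (\<forall>C. (\<forall>k x. 0 < k \<and> k < p \<and> x \<in> C \<longrightarrow> of_nat k * x \<in> C) \<longrightarrow> (\<Sum>x\<in>C. \<psi> x) \<in> \<int>)"
proof -
  obtain T :: "'a \<Rightarrow> nat" where T: "\<And>x. T x < p" "\<And>x y. T (x + y) = (T x + T y) mod p"
    and T_nz: "\<exists>x. T x \<noteq> 0"
    using ex_trace_functional[OF assms] by blast
  have T0: "T 0 = 0"
  proof -
    have "[T 0 = T 0 + T 0] (mod p)"
      using T(2)[of 0 0] by (simp add: cong_def T(1))
    then have "[0 = T 0] (mod p)"
      by (metis add.right_neutral cong_add_lcancel_nat)
    then show ?thesis using T(1)[of 0] by (simp add: cong_def)
  qed
  have T_mult: "T (of_nat k * x) = (k * T x) mod p" for k x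
  proof (induction k)
    case (Suc k)
    have "T (of_nat (Suc k) * x) = (T x + T (of_nat k * x)) mod p"
      by (simp add: distrib_right T(2))
    also have "\<dots> = (T x + k * T x) mod p"
      by (simp only: Suc mod_add_right_eq)
    finally show ?case by simp
  qed (simp add: T0)
  define \<zeta> where "\<zeta> = cis (2 * pi / p)"
  have p1: "p > 1" by (rule prime_gt_1_nat[OF p])
  have zeta_p: "\<zeta> ^ p = 1"
    using p1 by (simp add: \<zeta>_def DeMoivre)
  have zeta_mod: "\<zeta> ^ (k mod p) = \<zeta> ^ k" for k
  proof -
    have "\<zeta> ^ k = \<zeta> ^ (p * (k div p) + k mod p)" by simp
    also have "\<dots> = \<zeta> ^ (k mod p)" by (simp only: power_add power_mult zeta_p) simp
    finally show ?thesis by simp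
  qed
  have zeta_ne: "\<zeta> ^ k \<noteq> 1" if "0 < k" "k < p" for k
  proof
    assume "\<zeta> ^ k = 1"
    then have "(\<lambda>k. cis (2 * pi * real k / real p)) k = (\<lambda>k. cis (2 * pi * real k / real p)) 0"
      by (simp add: \<zeta>_def DeMoivre mult_ac)
    moreover have inj: "inj_on (\<lambda>k. cis (2 * pi * real k / real p)) {..<p}"
      using bij_betw_roots_unity[of p] p1 by (auto simp: bij_betw_def)
    ultimately have "k = 0" using that inj_onD[OF inj, of k 0] by simp
    with that show False by simp
  qed
  define \<psi> where "\<psi> = (\<lambda>x. \<zeta> ^ T x)"
  have add: "\<psi> (x + y) = \<psi> x * \<psi> y" for x y
    by (simp add: \<psi>_def T(2) zeta_mod power_add)
  have "\<psi> 0 = 1" by (simp add: \<psi>_def T0)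
  moreover have "\<exists>x. \<psi> x \<noteq> 1"
    using T_nz zeta_ne T(1) by (auto simp: \<psi>_def)
  moreover have "(\<Sum>x\<in>C. \<psi> x) \<in> \<int>"
    if C: "\<forall>k x. 0 < k \<and> k < p \<and> x \<in> C \<longrightarrow> of_nat k * x \<in> C" for C
  proof -
    define N where "N = (\<lambda>k. card {x\<in>C. T x = k})"
    \<comment> \<open>A factor \<open>k\<close> with \<open>k * a\<close> congruent to
      \<open>b\<close> maps the part of \<open>C\<close> with trace \<open>a\<close> injectively
      into the part with trace \<open>b\<close>.\<close>
    have N_le: "N a \<le> N b" if "0 < a" "a < p" "0 < b" "b < p" for a b
    proof -
      have "coprime a p" using that p
        by (metis coprime_commute nat_dvd_not_less prime_imp_coprime_nat)
      then obtain x where "[a * x = 1] (mod p)"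
        using cong_solve_coprime_nat[of a p] by auto
      then have ax: "[a * (x * b) = b] (mod p)"
        by (metis cong_scalar_right mult.assoc mult_1)
      define k where "k = (x * b) mod p"
      have ka: "(k * a) mod p = b"
      proof -
        have "(k * a) mod p = (x * b * a) mod p" by (simp only: k_def mod_mult_left_eq)
        also have "\<dots> = (a * (x * b)) mod p" by (simp only: mult_ac)
        also have "\<dots> = b mod p" using ax by (simp only: cong_def)
        finally show ?thesis using that by simp
      qed
      have k: "0 < k" "k < p"
      proof -
        show "0 < k" using ka that by (cases "k = 0") auto
        show "k < p" using p1 by (simp add: k_def)
      qed
      have "of_nat k \<noteq> (0::'a)"
      proof
        assume k0: "of_nat k = (0::'a)"
        obtain y where y: "T y \<noteq> 0" using T_nz by blast
        have "T (of_nat k * y) = 0" using k0 by (simp add: T0)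
        then have "p dvd k * T y" by (simp add: T_mult dvd_eq_mod_eq_0)
        then have "p dvd k \<or> p dvd T y" using p by (simp add: prime_dvd_mult_iff)
        then show False using k y T(1)[of y] by (auto dest!: dvd_imp_le)
      qed
      then have "inj_on ((*) (of_nat k)) {x\<in>C. T x = a}" by (intro inj_onI) simp
      moreover have "(*) (of_nat k) ` {x\<in>C. T x = a} \<subseteq> {x\<in>C. T x = b}"
      proof
        fix y assume "y \<in> (*) (of_nat k) ` {x\<in>C. T x = a}"
        then obtain x where x: "x \<in> C" "T x = a" "y = of_nat k * x" by blast
        then show "y \<in> {x\<in>C. T x = b}" using C k ka T_mult[of k x] by simp
      qed
      ultimately show ?thesis unfolding N_def by (rule card_inj_on_le) simp
    qed
    have N_eq: "N a = N 1" if "0 < a" "a < p" for a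
      using N_le[of a 1] N_le[of 1 a] that p1 by auto
    have "(\<Sum>x\<in>C. \<psi> x) = (\<Sum>k<p. \<Sum>x\<in>{x\<in>C. T x = k}. \<psi> x)"
      by (rule sum.group[symmetric]) (use T(1) in auto)
    also have "\<dots> = (\<Sum>k<p. of_nat (N k) * \<zeta> ^ k)"
      by (intro sum.cong refl) (simp add: \<psi>_def N_def)
    \<comment> \<open>Only the fibre over 0 deviates from \<open>N 1\<close>, so the rest is a
      multiple of the vanishing sum of all \<open>p\<close>-th roots of unity.\<close>
    also have "\<dots> = (\<Sum>k<p. (if k = 0 then of_nat (N 0) - of_nat (N 1) else 0) + of_nat (N 1) * \<zeta> ^ k)"
    proof (intro sum.cong refl)
      fix k assume "k \<in> {..<p}"
      then show "of_nat (N k) * \<zeta> ^ k =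
          (if k = 0 then of_nat (N 0) - of_nat (N 1) else 0) + of_nat (N 1) * \<zeta> ^ k"
        using N_eq[of k] by (cases "k = 0") simp_all
    qed
    also have "\<dots> = of_nat (N 0) - of_nat (N 1) + of_nat (N 1) * (\<Sum>k<p. \<zeta> ^ k)"
      using p1 by (simp add: sum.distrib sum_distrib_left)
    also have "(\<Sum>k<p. \<zeta> ^ k) = 0"
      using zeta_ne[of 1] p1 by (simp add: geometric_sum zeta_p)
    finally show ?thesis by simp
  qed
  ultimately show ?thesis using add by blast
qed

section \<open>Quartic cyclotomic classes\<close>

text \<open>At most \<open>2 * n\<close> of the \<open>4 * n\<close> units satisfy
  \<open>y ^ (2 * n) = 1\<close>. Any other unit has \<open>y ^ (2 * n) = - 1\<close>, so
  \<open>y ^ n\<close> is the required root.\<close>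

lemma sqrt_minus_one_exists:
  assumes card: "CARD('a::{field,finite}) = 4 * n + 1" and "n > 0"
  shows "\<exists>\<iota> :: 'a. \<iota>\<^sup>2 = - 1"
proof -
  have "\<not> UNIV - {0 :: 'a} \<subseteq> {y. y ^ (2 * n) = 1}"
  proof
    assume "UNIV - {0 :: 'a} \<subseteq> {y. y ^ (2 * n) = 1}"
    then have "4 * n \<le> card {y :: 'a. y ^ (2 * n) = 1}"
      using card card_mono[of "{y :: 'a. y ^ (2 * n) = 1}" "UNIV - {0}"] by (simp add: card_units)
    also have "\<dots> \<le> 2 * n" by (rule card_power_roots_le) (use assms in simp)
    finally show False using assms by simp
  qed
  then obtain y :: 'a where y: "y \<noteq> 0" "y ^ (2 * n) \<noteq> 1" by auto
  have "(y ^ (2 * n))\<^sup>2 = y ^ (4 * n)"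
    by (simp flip: power_mult)
  also have "\<dots> = 1" using power_card_minus_1[OF y(1)] card by simp
  finally have "(y ^ (2 * n))\<^sup>2 = 1" .
  with y have "y ^ (2 * n) = - 1" by (simp add: power2_eq_1_iff)
  then show ?thesis
    by (metis power_mult mult.commute)
qed

text \<open>Evenness of \<open>n\<close> makes \<open>- 1\<close> a fourth power and hence the graph
  undirected; \<open>\<iota>\<close> is the counterpart in the field of the complex
  \<open>\<i>\<close>.\<close>

locale quartic_field =
  fixes n :: nat and \<iota> :: "'a::{field,finite}"
  assumes card_field: "CARD('a) = 4 * n + 1"
    and n_even: "even n" and n_pos: "n > 0"
    and iota_sq: "\<iota>\<^sup>2 = - 1"
begin

lemma two_nz: "(2 :: 'a) \<noteq> 0"
proof
  assume two: "(2 :: 'a) = 0"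
  have "(0 :: 'a) = of_nat (4 * n + 1)"
    using of_nat_card_UNIV_eq_0[where 'a = 'a] card_field by simp
  also have "\<dots> = 2 * 2 * of_nat n + 1" by simp
  finally show False using two by simp
qed

lemma one_neq_minus_one: "(1 :: 'a) \<noteq> - 1"
  using two_nz by (metis add.right_inverse one_add_one)

lemma iota_pow4: "\<iota> ^ 4 = 1"
proof -
  have "\<iota> ^ 4 = (\<iota>\<^sup>2)\<^sup>2" by (simp flip: power_mult)
  then show ?thesis by (simp add: iota_sq)
qed

lemma iota_nz [simp]: "\<iota> \<noteq> 0"
  using iota_sq by auto

lemma iota_pow_mod: "\<iota> ^ (j mod 4) = \<iota> ^ j"
proof -
  have "\<iota> ^ j = \<iota> ^ (4 * (j div 4) + j mod 4)" by simp
  also have "\<dots> = \<iota> ^ (j mod 4)" by (simp only: power_add power_mult iota_pow4) simp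
  finally show ?thesis by simp
qed

lemma iota_pow_neq_1:
  assumes "0 < j" "j < 4"
  shows "\<iota> ^ j \<noteq> 1"
proof
  assume *: "\<iota> ^ j = 1"
  consider "j = 1" | "j = 2" | "j = 3" using assms by linarith
  then show False
  proof cases
    case 1
    then show ?thesis using * iota_sq one_neq_minus_one by simp
  next
    case 2
    then show ?thesis using * iota_sq one_neq_minus_one by simp
  next
    case 3
    have "\<iota> ^ 4 = \<iota> ^ 3 * \<iota>" by (simp flip: power_Suc2)
    then have "\<iota> = 1" using * 3 iota_pow4 by simp
    then show ?thesis using iota_sq one_neq_minus_one by simp
  qed
qed

lemma iota_pow_eq_iff: "\<iota> ^ j = \<iota> ^ k \<longleftrightarrow> j mod 4 = k mod 4"
proof
  have *: "j mod 4 = k mod 4" if "\<iota> ^ j = \<iota> ^ k" "j mod 4 \<le> k mod 4" for j k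
  proof -
    have "\<iota> ^ (j mod 4) * \<iota> ^ (k mod 4 - j mod 4) = \<iota> ^ (j mod 4)"
      using that by (simp only: flip: power_add) (simp add: iota_pow_mod)
    then have "\<iota> ^ (k mod 4 - j mod 4) = 1" by simp
    then have "\<not> (0 < k mod 4 - j mod 4)"
      using iota_pow_neq_1[of "k mod 4 - j mod 4"]
      by (metis less_imp_diff_less mod_less_divisor zero_less_numeral)
    with that show ?thesis by simp
  qed
  assume "\<iota> ^ j = \<iota> ^ k"
  then show "j mod 4 = k mod 4"
    using *[of j k] *[of k j] by (cases "j mod 4 \<le> k mod 4") auto
qed (metis iota_pow_mod)

text \<open>The class is read off from \<open>x ^ n\<close>, so that no generator of the unit group
  has to be chosen; the index counts modulo 4.\<close>

definition cls :: "nat \<Rightarrow> 'a set" where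
  "cls j = {x. x ^ n = \<iota> ^ j}"

lemma cls_mod: "cls (j mod 4) = cls j"
  by (simp add: cls_def iota_pow_mod)

lemma zero_notin_cls [simp]: "0 \<notin> cls j"
  using n_pos by (simp add: cls_def power_0_left)

text \<open>\<open>x ^ n\<close> is a fourth root of unity, and all of these are powers of
  \<open>\<iota>\<close>.\<close>

lemma in_cls_cases:
  assumes "x \<noteq> 0"
  shows "\<exists>j<4. x \<in> cls j"
proof -
  define z where "z = x ^ n"
  have "(z\<^sup>2)\<^sup>2 = x ^ (4 * n)"
    unfolding z_def by (simp flip: power_mult)
  also have "\<dots> = 1" using power_card_minus_1[OF assms] card_field by simp
  finally have "(z\<^sup>2)\<^sup>2 = 1" .
  then consider "z\<^sup>2 = 1" | "z\<^sup>2 = - 1"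
    using power2_eq_1_iff[of "z\<^sup>2"] by blast
  then have "z = \<iota> ^ 0 \<or> z = \<iota> ^ 2 \<or> z = \<iota> ^ 1 \<or> z = \<iota> ^ 3"
  proof cases
    case 1
    then have "z = 1 \<or> z = - 1" using power2_eq_1_iff[of z] by blast
    then show ?thesis by (metis iota_sq power_0)
  next
    case 2
    then have "z = \<iota> \<or> z = - \<iota>" using power2_eq_iff[of z \<iota>] iota_sq by simp
    moreover have "\<iota> ^ 3 = \<iota>\<^sup>2 * \<iota>" by (simp add: power3_eq_cube power2_eq_square)
    then have "\<iota> ^ 3 = - \<iota>" by (simp add: iota_sq)
    ultimately show ?thesis by (metis power_one_right)
  qed
  moreover have "(0::nat) < 4" "(1::nat) < 4" "(2::nat) < 4" "(3::nat) < 4" by auto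
  ultimately show ?thesis
    unfolding cls_def z_def by blast
qed

lemma cls_unique:
  assumes "x \<in> cls j" "x \<in> cls k"
  shows "j mod 4 = k mod 4"
  using assms iota_pow_eq_iff[of j k] by (simp add: cls_def)

lemma cls_mult: "x \<in> cls j \<Longrightarrow> y \<in> cls k \<Longrightarrow> x * y \<in> cls (j + k)"
  by (simp add: cls_def power_mult_distrib power_add)

lemma mult_in_cls_iff:
  assumes "x \<in> cls j"
  shows "x * y \<in> cls (j + k) \<longleftrightarrow> y \<in> cls k"
  using assms by (auto simp: cls_def power_mult_distrib power_add)

lemma UN_cls: "(\<Union>j<4. cls j) = UNIV - {0}"
  using in_cls_cases by fastforce

lemma sum_cls: "(\<Sum>x\<in>UNIV. F x) = F 0 + (\<Sum>j<4. \<Sum>x\<in>cls j. F x)"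
proof -
  have "(\<Sum>x\<in>UNIV. F x) = F 0 + (\<Sum>x\<in>UNIV - {0}. F x)"
    by (rule sum.remove) auto
  also have "(\<Sum>x\<in>UNIV - {0}. F x) = (\<Sum>x\<in>(\<Union>j<4. cls j). F x)"
    by (simp only: UN_cls)
  also have "\<dots> = (\<Sum>j<4. \<Sum>x\<in>cls j. F x)"
  proof (rule sum.UNION_disjoint)
    have "cls i \<inter> cls j = {}" if "i < 4" "j < 4" "i \<noteq> j" for i j
    proof (rule ccontr)
      assume "cls i \<inter> cls j \<noteq> {}"
      then obtain x where "x \<in> cls i" "x \<in> cls j" by blast
      then have "i mod 4 = j mod 4" by (rule cls_unique)
      with that show False by simp
    qed
    then show "\<forall>i\<in>{..<4}. \<forall>j\<in>{..<4}. i \<noteq> j \<longrightarrow> cls i \<inter> cls j = {}" by simp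
  qed simp_all
  finally show ?thesis .
qed

text \<open>Each class has at most \<open>n\<close> elements, as a set of roots, and the four
  classes exhaust the \<open>4 * n\<close> units.\<close>

lemma card_cls: "card (cls j) = n"
proof -
  have le: "card (cls j) \<le> n" for j
    unfolding cls_def by (rule card_power_roots_le[OF n_pos])
  have "4 * n + 1 = 1 + (\<Sum>j<4. card (cls j))"
    using sum_cls[of "\<lambda>_. 1 :: nat"] card_field by simp
  then have "4 * n = card (cls 0) + card (cls 1) + card (cls 2) + card (cls 3)"
    by (simp add: eval_nat_numeral)
  then have "card (cls 0) = n" "card (cls 1) = n" "card (cls 2) = n" "card (cls 3) = n"
    using le[of 0] le[of 1] le[of 2] le[of 3] by linarith+
  moreover have "j mod 4 = 0 \<or> j mod 4 = 1 \<or> j mod 4 = 2 \<or> j mod 4 = 3" by linarith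
  ultimately show ?thesis using cls_mod[of j] by metis
qed

text \<open>One inclusion is \<open>x ^ (4 * n) = 1\<close>. Equality follows by counting: every
  element has at most four fourth roots, so there are at least \<open>n\<close> fourth
  powers.\<close>

lemma power_residues_4: "power_residues 4 = cls 0"
proof (rule card_seteq)
  let ?R = "power_residues 4 :: 'a set"
  show "?R \<subseteq> cls 0"
    using card_field power_card_minus_1[where 'a = 'a]
    by (auto simp: power_residues_def cls_def simp flip: power_mult)
  have "4 * n = card (UNIV - {0 :: 'a})" by (simp add: card_units card_field)
  also have "UNIV - {0 :: 'a} \<subseteq> (\<Union>y\<in>?R. {x. x ^ 4 = y})"
    by (auto simp: power_residues_def)
  then have "card (UNIV - {0 :: 'a}) \<le> card (\<Union>y\<in>?R. {x. x ^ 4 = y})"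
    by (rule card_mono[rotated]) simp
  also have "\<dots> \<le> (\<Sum>y\<in>?R. card {x. x ^ 4 = y})" by (rule card_UN_le) simp
  also have "\<dots> \<le> (\<Sum>y\<in>?R. 4)" by (intro sum_mono card_power_roots_le) simp
  finally show "card (cls 0) \<le> card ?R" by (simp add: card_cls)
qed simp

lemma minus_one_cls: "- 1 \<in> cls 0"
  using n_even by (simp add: cls_def)

lemma minus_in_cls_iff: "- x \<in> cls j \<longleftrightarrow> x \<in> cls j"
  using mult_in_cls_iff[OF minus_one_cls, of x j] by simp

text \<open>For nonzero \<open>x\<close> the index is determined only modulo 4, which is all that
  \<open>\<i> ^ ind x\<close> depends on.\<close>

definition ind :: "'a \<Rightarrow> nat" where
  "ind x = (SOME j. x \<in> cls j)"

lemma in_cls_ind: "x \<noteq> 0 \<Longrightarrow> x \<in> cls (ind x)"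
  unfolding ind_def using in_cls_cases by (metis someI)

definition chi :: "'a \<Rightarrow> complex" where
  "chi x = (if x = 0 then 0 else \<i> ^ ind x)"

lemma i_pow_mod: "\<i> ^ (j mod 4) = \<i> ^ j"
proof -
  have "\<i> ^ j = \<i> ^ (4 * (j div 4) + j mod 4)" by simp
  also have "\<dots> = \<i> ^ (j mod 4)" by (simp only: power_add power_mult) simp
  finally show ?thesis by simp
qed

lemma chi_cls: "x \<in> cls j \<Longrightarrow> chi x = \<i> ^ j"
  using cls_unique[of x j "ind x"] in_cls_ind[of x] i_pow_mod[of j] i_pow_mod[of "ind x"]
  by (cases "x = 0") (auto simp: chi_def)

lemma chi_0 [simp]: "chi 0 = 0"
  by (simp add: chi_def)

lemma chi_mult: "chi (x * y) = chi x * chi y"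
proof (cases "x = 0 \<or> y = 0")
  case False
  then obtain j k where "x \<in> cls j" "y \<in> cls k" using in_cls_cases by metis
  then show ?thesis using cls_mult[of x j y k] by (simp add: chi_cls power_add)
qed auto

lemma cls_nonempty: "\<exists>x. x \<in> cls j"
  using card_cls[of j] n_pos by (metis card.empty ex_in_conv not_gr_zero)

end

section \<open>Gauss and Jacobi sums\<close>

definition mult_char :: "('a::{field,finite} \<Rightarrow> complex) \<Rightarrow> bool" where
  "mult_char f \<longleftrightarrow> (\<forall>x y. f (x * y) = f x * f y) \<and> f 0 = 0 \<and> f 1 = 1"

lemma mult_char_mult: "mult_char f \<Longrightarrow> mult_char g \<Longrightarrow> mult_char (\<lambda>x. f x * g x)"
  by (auto simp: mult_char_def)

lemma sum_mult_char:
  assumes f: "mult_char f" and "f y \<noteq> 1" "y \<noteq> 0"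
  shows "(\<Sum>x\<in>UNIV. f x) = 0"
proof -
  have "(\<Sum>x\<in>UNIV. f x) = (\<Sum>x\<in>UNIV. f (y * x))"
    by (rule sum.reindex_bij_witness[of _ "\<lambda>x. y * x" "\<lambda>x. x / y"]) (use assms in auto)
  also have "\<dots> = f y * (\<Sum>x\<in>UNIV. f x)"
    using f by (simp add: mult_char_def sum_distrib_left)
  finally show ?thesis using assms by simp
qed

locale additive_char =
  fixes \<psi> :: "'a::{field,finite} \<Rightarrow> complex"
  assumes psi_add: "\<psi> (x + y) = \<psi> x * \<psi> y"
    and psi_0: "\<psi> 0 = 1"
    and psi_nontrivial: "\<exists>x. \<psi> x \<noteq> 1"
begin

lemma psi_sum: "(\<Sum>x\<in>UNIV. \<psi> (b * x)) = (if b = 0 then of_nat CARD('a) else 0)"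
proof (cases "b = 0")
  case False
  obtain y where y: "\<psi> y \<noteq> 1" using psi_nontrivial by blast
  have "(\<Sum>x\<in>UNIV. \<psi> (b * x)) = (\<Sum>x\<in>UNIV. \<psi> x)"
    by (rule sum.reindex_bij_witness[of _ "\<lambda>x. x / b" "\<lambda>x. b * x"]) (use False in auto)
  also have "(\<Sum>x\<in>UNIV. \<psi> x) = 0"
  proof -
    have "(\<Sum>x\<in>UNIV. \<psi> x) = (\<Sum>x\<in>UNIV. \<psi> (y + x))"
      by (rule sum.reindex_bij_witness[of _ "\<lambda>x. y + x" "\<lambda>x. x - y"]) auto
    also have "\<dots> = \<psi> y * (\<Sum>x\<in>UNIV. \<psi> x)"
      by (simp add: psi_add sum_distrib_left)
    finally show ?thesis using y by simp
  qed
  finally show ?thesis using False by simp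
qed (simp add: psi_0)

definition gauss_sum :: "('a \<Rightarrow> complex) \<Rightarrow> complex" where
  "gauss_sum f = (\<Sum>x\<in>UNIV. f x * \<psi> x)"

text \<open>This is the classical norm of a Gauss sum in product form. After the substitution
  \<open>x = u * y\<close> the variables separate, and orthogonality of \<open>\<psi>\<close>
  singles out \<open>u = - 1\<close>.\<close>

lemma gauss_sum_mult_inverse:
  assumes f: "mult_char f" and g: "mult_char g" and fg: "\<And>x. x \<noteq> 0 \<Longrightarrow> f x * g x = 1"
    and nontriv: "f z \<noteq> 1" "z \<noteq> 0"
  shows "gauss_sum f * gauss_sum g = of_nat CARD('a) * f (- 1)"
proof -
  have "gauss_sum f * gauss_sum g = (\<Sum>y\<in>UNIV. \<Sum>x\<in>UNIV. f x * g y * \<psi> (x + y))"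
    unfolding gauss_sum_def sum_product
    by (subst sum.swap) (simp add: psi_add mult_ac)
  also have "\<dots> = (\<Sum>y\<in>UNIV. \<Sum>u\<in>UNIV. f u * (if y = 0 then 0 else \<psi> ((u + 1) * y)))"
  proof (rule sum.cong[OF refl])
    fix y :: 'a
    show "(\<Sum>x\<in>UNIV. f x * g y * \<psi> (x + y)) =
      (\<Sum>u\<in>UNIV. f u * (if y = 0 then 0 else \<psi> ((u + 1) * y)))"
    proof (cases "y = 0")
      case True
      then show ?thesis using g by (simp add: mult_char_def)
    next
      case False
      have "(\<Sum>x\<in>UNIV. f x * g y * \<psi> (x + y)) = (\<Sum>u\<in>UNIV. f (u * y) * g y * \<psi> (u * y + y))"
        by (rule sum.reindex_bij_witness[of _ "\<lambda>u. u * y" "\<lambda>x. x / y"]) (use False in auto)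
      also have "\<dots> = (\<Sum>u\<in>UNIV. f u * \<psi> ((u + 1) * y))"
      proof (rule sum.cong[OF refl])
        fix u
        have "f (u * y) * g y = f u * (f y * g y)" using f by (simp add: mult_char_def)
        then show "f (u * y) * g y * \<psi> (u * y + y) = f u * \<psi> ((u + 1) * y)"
          using fg[OF False] by (simp add: distrib_right)
      qed
      finally show ?thesis using False by simp
    qed
  qed
  also have "\<dots> = (\<Sum>u\<in>UNIV. f u * (\<Sum>y\<in>UNIV. if y = 0 then 0 else \<psi> ((u + 1) * y)))"
    by (subst sum.swap) (simp add: sum_distrib_left)
  \<comment> \<open>The missing term \<open>y = 0\<close> of the orthogonality relation accounts for
    the \<open>- 1\<close>.\<close>
  also have "\<dots> = (\<Sum>u\<in>UNIV. f u * ((if u = - 1 then of_nat CARD('a) else 0) - 1))"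
  proof (rule sum.cong[OF refl])
    fix u :: 'a
    have "(\<Sum>y\<in>UNIV. if y = 0 then 0 else \<psi> ((u + 1) * y)) =
        (\<Sum>y\<in>UNIV. \<psi> ((u + 1) * y) - (if y = 0 then 1 else 0))"
      by (rule sum.cong) (auto simp: psi_0)
    also have "\<dots> = (if u + 1 = 0 then of_nat CARD('a) else 0) - 1"
      by (simp add: sum_subtractf psi_sum)
    finally show "f u * (\<Sum>y\<in>UNIV. if y = 0 then 0 else \<psi> ((u + 1) * y)) =
        f u * ((if u = - 1 then of_nat CARD('a) else 0) - 1)"
      by (simp add: eq_neg_iff_add_eq_0)
  qed
  also have "\<dots> = (\<Sum>u\<in>UNIV. if u = - 1 then of_nat CARD('a) * f u else 0) - (\<Sum>u\<in>UNIV. f u)"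
    unfolding sum_subtractf[symmetric] by (rule sum.cong) (auto simp: algebra_simps)
  also have "\<dots> = of_nat CARD('a) * f (- 1)"
    using sum_mult_char[OF f nontriv] by simp
  finally show ?thesis .
qed

text \<open>The pairs with sum \<open>t\<close> are collected; scaling by \<open>t\<close> turns the
  inner sum into the Jacobi sum times \<open>f t * f t\<close>.\<close>

lemma gauss_sum_square:
  assumes f: "mult_char f" and nontriv: "f z * f z \<noteq> 1" "z \<noteq> 0"
  shows "(gauss_sum f)\<^sup>2 = (\<Sum>u\<in>UNIV. f u * f (1 - u)) * gauss_sum (\<lambda>x. f x * f x)"
proof -
  let ?J = "\<Sum>u\<in>UNIV. f u * f (1 - u)"
  have ff: "mult_char (\<lambda>x. f x * f x)" by (rule mult_char_mult[OF f f])
  have "(gauss_sum f)\<^sup>2 = (\<Sum>x\<in>UNIV. \<Sum>y\<in>UNIV. f x * f y * \<psi> (x + y))"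
    unfolding gauss_sum_def power2_eq_square sum_product
    by (simp add: psi_add mult_ac)
  also have "\<dots> = (\<Sum>x\<in>UNIV. \<Sum>t\<in>UNIV. f x * f (t - x) * \<psi> t)"
  proof (rule sum.cong[OF refl])
    fix x :: 'a
    show "(\<Sum>y\<in>UNIV. f x * f y * \<psi> (x + y)) = (\<Sum>t\<in>UNIV. f x * f (t - x) * \<psi> t)"
      by (rule sum.reindex_bij_witness[of _ "\<lambda>t. t - x" "\<lambda>y. x + y"]) auto
  qed
  also have "\<dots> = (\<Sum>t\<in>UNIV. (\<Sum>x\<in>UNIV. f x * f (t - x)) * \<psi> t)"
    by (subst sum.swap) (simp add: sum_distrib_right)
  also have "\<dots> = (\<Sum>t\<in>UNIV. ?J * (f t * f t * \<psi> t))"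
  proof (rule sum.cong[OF refl])
    fix t :: 'a
    have "(\<Sum>x\<in>UNIV. f x * f (t - x)) = ?J * (f t * f t)"
    proof (cases "t = 0")
      \<comment> \<open>Scaling is impossible here, but the sum vanishes because the square of
        \<open>f\<close> is a nontrivial character.\<close>
      case True
      have "f x * f (t - x) = f (- 1) * (f x * f x)" for x
      proof -
        have "f (- 1 * x) = f (- 1) * f x" using f by (simp only: mult_char_def)
        then show ?thesis using True by simp
      qed
      then have "(\<Sum>x\<in>UNIV. f x * f (t - x)) = f (- 1) * (\<Sum>x\<in>UNIV. f x * f x)"
        by (simp only: sum_distrib_left)
      then show ?thesis
        using sum_mult_char[OF ff nontriv] True f by (simp add: mult_char_def)
    next
      case False
      have "(\<Sum>x\<in>UNIV. f x * f (t - x)) = (\<Sum>u\<in>UNIV. f (t * u) * f (t - t * u))"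
        by (rule sum.reindex_bij_witness[of _ "\<lambda>u. t * u" "\<lambda>x. x / t"]) (use False in auto)
      also have "\<dots> = (\<Sum>u\<in>UNIV. f u * f (1 - u) * (f t * f t))"
      proof (rule sum.cong[OF refl])
        fix u
        have "t - t * u = t * (1 - u)" by (simp add: algebra_simps)
        then show "f (t * u) * f (t - t * u) = f u * f (1 - u) * (f t * f t)"
          using f by (simp add: mult_char_def)
      qed
      finally show ?thesis by (simp add: sum_distrib_right)
    qed
    then show "(\<Sum>x\<in>UNIV. f x * f (t - x)) * \<psi> t = ?J * (f t * f t * \<psi> t)" by simp
  qed
  finally show ?thesis by (simp add: gauss_sum_def sum_distrib_left)
qed

end

locale quartic_gauss = quartic_field n \<iota> + additive_char \<psi>
  for n and \<iota> :: "'a::{field,finite}" and \<psi> :: "'a \<Rightarrow> complex"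
begin

text \<open>These are the Gaussian periods of order 4.\<close>

definition \<eta> :: "nat \<Rightarrow> complex" where
  "\<eta> j = (\<Sum>x\<in>cls j. \<psi> x)"

lemma \<eta>_mod: "\<eta> (j mod 4) = \<eta> j"
  by (simp add: \<eta>_def cls_mod)

lemma sum_psi_cls:
  assumes "b \<in> cls j"
  shows "(\<Sum>x\<in>cls k. \<psi> (b * x)) = \<eta> (j + k)"
  unfolding \<eta>_def
proof (rule sum.reindex_bij_witness[of _ "\<lambda>x. x / b" "\<lambda>x. b * x"])
  have "b \<noteq> 0" using assms by auto
  then show "b * (x / b) = x" "b * x / b = x" for x by auto
  then show "x / b \<in> cls k" if "x \<in> cls (j + k)" for x
    using that mult_in_cls_iff[OF assms, of "x / b" k] by simp
  show "b * x \<in> cls (j + k)" if "x \<in> cls k" for x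
    using cls_mult[OF assms that] .
qed auto

lemma sum_\<eta>: "\<eta> 0 + \<eta> 1 + \<eta> 2 + \<eta> 3 = - 1"
proof -
  have "0 = \<psi> 0 + (\<Sum>j<4. \<eta> j)"
    using psi_sum[of 1] sum_cls[of \<psi>] by (simp add: \<eta>_def)
  also have "(\<Sum>j<4. \<eta> j) = \<eta> 0 + \<eta> 1 + \<eta> 2 + \<eta> 3"
    by (simp add: eval_nat_numeral)
  finally show ?thesis by (simp add: psi_0 algebra_simps eq_neg_iff_add_eq_0)
qed

lemma mult_char_chi: "mult_char chi"
proof -
  have "1 \<in> cls 0" by (simp add: cls_def)
  then show ?thesis by (simp add: mult_char_def chi_mult chi_cls)
qed

lemma gauss_sum_cls:
  assumes "f 0 = 0" and "\<And>j x. x \<in> cls j \<Longrightarrow> f x = c j"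
  shows "gauss_sum f = c 0 * \<eta> 0 + c 1 * \<eta> 1 + c 2 * \<eta> 2 + c 3 * \<eta> 3"
proof -
  have "gauss_sum f = (\<Sum>j<4. \<Sum>x\<in>cls j. f x * \<psi> x)"
    unfolding gauss_sum_def by (subst sum_cls) (simp add: assms(1))
  also have "\<dots> = (\<Sum>j<4. c j * \<eta> j)"
    unfolding \<eta>_def sum_distrib_left by (intro sum.cong refl) (simp add: assms(2))
  finally show ?thesis by (simp add: eval_nat_numeral)
qed

lemma gauss_sum_chi: "gauss_sum chi = (\<eta> 0 - \<eta> 2) + \<i> * (\<eta> 1 - \<eta> 3)"
  by (subst gauss_sum_cls[where c = "\<lambda>j. \<i> ^ j"]) (simp_all add: chi_cls power3_eq_cube algebra_simps)

lemma gauss_sum_chi2: "gauss_sum (\<lambda>x. chi x * chi x) = \<eta> 0 + \<eta> 2 - \<eta> 1 - \<eta> 3"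
  by (subst gauss_sum_cls[where c = "\<lambda>j. \<i> ^ j * \<i> ^ j"])
    (simp_all add: chi_cls power3_eq_cube algebra_simps power2_eq_square)

lemma gauss_sum_chi3: "gauss_sum (\<lambda>x. chi x * (chi x * chi x)) = (\<eta> 0 - \<eta> 2) - \<i> * (\<eta> 1 - \<eta> 3)"
  by (subst gauss_sum_cls[where c = "\<lambda>j. \<i> ^ j * (\<i> ^ j * \<i> ^ j)"])
    (simp_all add: chi_cls power3_eq_cube algebra_simps power2_eq_square)

lemma chi_pow4:
  assumes "x \<noteq> 0"
  shows "chi x * chi x * (chi x * chi x) = 1"
proof -
  have "chi x = \<i> ^ ind x" by (rule chi_cls[OF in_cls_ind[OF assms]])
  then have "chi x * chi x * (chi x * chi x) = (\<i> * \<i> * \<i> * \<i>) ^ ind x"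
    by (simp only: power_mult_distrib) (simp only: mult_ac)
  then show ?thesis by simp
qed

text \<open>The square of \<open>chi\<close> is its own inverse and takes the value 1 at
  \<open>- 1\<close>.\<close>

lemma norm_quadratic: "(\<eta> 0 + \<eta> 2 - \<eta> 1 - \<eta> 3)\<^sup>2 = of_nat (4 * n + 1)"
proof -
  obtain g where g: "g \<in> cls 1" using cls_nonempty by blast
  have cc: "mult_char (\<lambda>x. chi x * chi x)"
    by (rule mult_char_mult[OF mult_char_chi mult_char_chi])
  have "chi g = \<i>" using chi_cls[OF g] by simp
  then have ne: "chi g * chi g \<noteq> 1" by simp
  have "g \<noteq> 0" using g by auto
  then have "gauss_sum (\<lambda>x. chi x * chi x) * gauss_sum (\<lambda>x. chi x * chi x) =
      of_nat CARD('a) * (chi (- 1) * chi (- 1))"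
    using gauss_sum_mult_inverse[OF cc cc chi_pow4 ne] by simp
  also have "chi (- 1) = 1" using chi_cls[OF minus_one_cls] by simp
  finally show ?thesis by (simp add: gauss_sum_chi2 card_field power2_eq_square)
qed

text \<open>The cube of \<open>chi\<close> is its inverse. The product of the two Gauss sums is this
  sum of squares without any appeal to the periods being real.\<close>

lemma norm_quartic: "(\<eta> 0 - \<eta> 2)\<^sup>2 + (\<eta> 1 - \<eta> 3)\<^sup>2 = of_nat (4 * n + 1)"
proof -
  obtain g where g: "g \<in> cls 1" using cls_nonempty by blast
  have ccc: "mult_char (\<lambda>x. chi x * (chi x * chi x))"
    by (intro mult_char_mult mult_char_chi)
  have "chi g = \<i>" using chi_cls[OF g] by simp
  then have ne: "chi g \<noteq> 1" by simp
  have inv: "chi x * (chi x * (chi x * chi x)) = 1" if "x \<noteq> 0" for x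
    using chi_pow4[OF that] by (simp only: mult.assoc)
  have "g \<noteq> 0" using g by auto
  then have "gauss_sum chi * gauss_sum (\<lambda>x. chi x * (chi x * chi x)) = of_nat CARD('a) * chi (- 1)"
    using gauss_sum_mult_inverse[OF mult_char_chi ccc inv ne] by simp
  also have "chi (- 1) = 1" using chi_cls[OF minus_one_cls] by simp
  finally show ?thesis
    by (simp add: gauss_sum_chi gauss_sum_chi3 card_field power2_eq_square algebra_simps)
qed

text \<open>Weighted with \<open>\<i> ^ j\<close>, the counts for \<open>j < 4\<close> add up to the
  Jacobi sum of \<open>chi\<close> with itself. As integers they can also be read in the
  field.\<close>

definition jac :: "nat \<Rightarrow> int" where
  "jac j = int (card {x. x * (1 - x) \<in> cls j})"

lemma quartic_square:
  "((\<eta> 0 - \<eta> 2) + \<i> * (\<eta> 1 - \<eta> 3))\<^sup>2 =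
     (of_int (jac 0 - jac 2) + \<i> * of_int (jac 1 - jac 3)) * (\<eta> 0 + \<eta> 2 - \<eta> 1 - \<eta> 3)"
proof -
  obtain g where g: "g \<in> cls 1" using cls_nonempty by blast
  have "chi g = \<i>" using chi_cls[OF g] by simp
  then have ne: "chi g * chi g \<noteq> 1" by simp
  have g0: "g \<noteq> 0" using g by auto
  have "(\<Sum>u\<in>UNIV. chi u * chi (1 - u)) =
      (\<Sum>u\<in>UNIV. \<Sum>j<4. if u * (1 - u) \<in> cls j then \<i> ^ j else 0)"
  proof (rule sum.cong[OF refl])
    fix u :: 'a
    show "chi u * chi (1 - u) = (\<Sum>j<4. if u * (1 - u) \<in> cls j then \<i> ^ j else 0)"
    proof (cases "u * (1 - u) = 0")
      case False
      then obtain k where k: "k < 4" "u * (1 - u) \<in> cls k" using in_cls_cases by metis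
      have "u * (1 - u) \<in> cls j \<longleftrightarrow> j = k" if "j < 4" for j
        using k that cls_unique[of "u * (1 - u)" j k] by auto
      then have "(\<Sum>j<4. if u * (1 - u) \<in> cls j then \<i> ^ j else 0) =
          (\<Sum>j<4. if j = k then \<i> ^ j else 0)"
        by (intro sum.cong refl) simp
      also have "\<dots> = \<i> ^ k" using k by simp
      finally show ?thesis using chi_cls[OF k(2)] by (simp add: chi_mult)
    next
      case True
      have "u * (1 - u) \<notin> cls j" for j unfolding True by simp
      moreover have "chi u * chi (1 - u) = 0" unfolding chi_mult[symmetric] True by simp
      ultimately show ?thesis by (simp only: if_False sum.neutral_const)
    qed
  qed
  also have "\<dots> = (\<Sum>j<4. of_int (jac j) * \<i> ^ j)"
    by (subst sum.swap) (simp add: jac_def flip: sum.inter_filter)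
  also have "\<dots> = of_int (jac 0 - jac 2) + \<i> * of_int (jac 1 - jac 3)"
    by (simp add: eval_nat_numeral algebra_simps)
  finally have "(\<Sum>u\<in>UNIV. chi u * chi (1 - u)) =
    of_int (jac 0 - jac 2) + \<i> * of_int (jac 1 - jac 3)" .
  then show ?thesis
    using gauss_sum_square[OF mult_char_chi ne g0] by (simp only: gauss_sum_chi gauss_sum_chi2)
qed

text \<open>
  The Jacobi sum, read in the field itself through \<open>\<i> \<mapsto> - \<iota>\<close>, is the power sum of
  \<open>(x (1 - x)) ^ (3 n)\<close>, in which only the monomial of degree \<open>4 n\<close> contributes.
\<close>

lemma jacobi_in_field:
  "of_int (jac 0 - jac 2) - \<iota> * of_int (jac 1 - jac 3) =
     (- of_nat ((3 * n) choose n) * (- 1) ^ n :: 'a)"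
proof -
  \<comment> \<open>On class \<open>j\<close> the power \<open>3 * n\<close> takes the value
    \<open>(\<iota> ^ 3) ^ j\<close>, so the counts reappear with \<open>- \<iota>\<close> in place
    of \<open>\<i>\<close>.\<close>
  have "(\<Sum>x\<in>UNIV. (x * (1 - x)) ^ (3 * n)) =
      (\<Sum>x\<in>UNIV. \<Sum>j<4. if x * (1 - x) \<in> cls j then (\<iota> ^ 3) ^ j else 0)"
  proof (rule sum.cong[OF refl])
    fix u :: 'a
    show "(u * (1 - u)) ^ (3 * n) = (\<Sum>j<4. if u * (1 - u) \<in> cls j then (\<iota> ^ 3) ^ j else 0)"
    proof (cases "u * (1 - u) = 0")
      case False
      then obtain k where k: "k < 4" "u * (1 - u) \<in> cls k" using in_cls_cases by metis
      have "u * (1 - u) \<in> cls j \<longleftrightarrow> j = k" if "j < 4" for j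
        using k that cls_unique[of "u * (1 - u)" j k] by auto
      then have "(\<Sum>j<4. if u * (1 - u) \<in> cls j then (\<iota> ^ 3) ^ j else 0) =
          (\<Sum>j<4. if j = k then (\<iota> ^ 3) ^ j else 0)"
        by (intro sum.cong refl) simp
      also have "\<dots> = (\<iota> ^ 3) ^ k" using k by simp
      also have "\<dots> = (\<iota> ^ k) ^ 3"
        by (simp only: mult.commute[of 3] flip: power_mult)
      also have "\<iota> ^ k = (u * (1 - u)) ^ n" using k by (simp only: cls_def mem_Collect_eq)
      also have "((u * (1 - u)) ^ n) ^ 3 = (u * (1 - u)) ^ (3 * n)"
        by (simp only: mult.commute[of 3] flip: power_mult)
      finally show ?thesis by simp
    next
      case True
      have "u * (1 - u) \<notin> cls j" for j unfolding True by simp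
      moreover have "(u * (1 - u)) ^ (3 * n) = 0" unfolding True using n_pos by simp
      ultimately show ?thesis by (simp only: if_False sum.neutral_const)
    qed
  qed
  also have "\<dots> = (\<Sum>j<4. of_int (jac j) * (\<iota> ^ 3) ^ j)"
    by (subst sum.swap) (simp add: jac_def flip: sum.inter_filter)
  also have "\<iota> ^ 3 = - \<iota>" using iota_sq by (simp add: power3_eq_cube power2_eq_square)
  also have "(\<Sum>j<4. of_int (jac j) * (- \<iota>) ^ j) =
      of_int (jac 0 - jac 2) - \<iota> * of_int (jac 1 - jac 3)"
    using iota_sq by (simp add: eval_nat_numeral algebra_simps)
  finally have 1: "(\<Sum>x\<in>UNIV. (x * (1 - x)) ^ (3 * n)) =
    of_int (jac 0 - jac 2) - \<iota> * of_int (jac 1 - jac 3)" .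
  have "(\<Sum>x\<in>UNIV. (x * (1 - x)) ^ (3 * n)) =
      (\<Sum>x\<in>UNIV. \<Sum>k\<le>3*n. of_nat ((3 * n) choose k) * (- 1) ^ k * x ^ (3 * n + k) :: 'a)"
  proof (rule sum.cong[OF refl])
    fix x :: 'a
    have "(1 - x) ^ (3 * n) = (\<Sum>k\<le>3*n. of_nat ((3 * n) choose k) * (- x) ^ k)"
      using binomial_ring[of "- x" 1 "3 * n"] by simp
    also have "\<dots> = (\<Sum>k\<le>3*n. of_nat ((3 * n) choose k) * (- 1) ^ k * x ^ k)"
      by (intro sum.cong refl) (simp add: power_minus[of x])
    finally show "(x * (1 - x)) ^ (3 * n) =
        (\<Sum>k\<le>3*n. of_nat ((3 * n) choose k) * (- 1) ^ k * x ^ (3 * n + k))"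
      by (simp add: power_mult_distrib sum_distrib_left power_add mult_ac)
  qed
  also have "\<dots> = (\<Sum>k\<le>3*n. of_nat ((3 * n) choose k) * (- 1) ^ k * (\<Sum>x\<in>UNIV. x ^ (3 * n + k)))"
    by (subst sum.swap) (simp add: sum_distrib_left)
  also have "\<dots> = (\<Sum>k\<le>3*n. if k = n then - of_nat ((3 * n) choose n) * (- 1) ^ n else 0)"
  proof (rule sum.cong[OF refl])
    fix k assume "k \<in> {..3 * n}"
    then have k: "k \<le> 3 * n" by simp
    show "of_nat ((3 * n) choose k) * (- 1) ^ k * (\<Sum>x\<in>UNIV. x ^ (3 * n + k)) =
        (if k = n then - of_nat ((3 * n) choose n) * (- 1) ^ n else 0 :: 'a)"
    proof (cases "k = n")
      case True
      then have "(\<Sum>x\<in>UNIV. x ^ (3 * n + k)) = (- 1 :: 'a)"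
        using sum_power_card_minus_1[where 'a = 'a] card_field by simp
      then show ?thesis using True by simp
    next
      case False
      \<comment> \<open>The exponent lies strictly between 0 and \<open>8 * n\<close>, so it could
        only be \<open>4 * n\<close>, that is \<open>k = n\<close>.\<close>
      have "\<not> 4 * n dvd 3 * n + k"
      proof
        assume "4 * n dvd 3 * n + k"
        then obtain c where c: "3 * n + k = 4 * n * c" by (rule dvdE)
        have "c \<noteq> 0" using c n_pos by (cases "c = 0") auto
        moreover have "c \<noteq> 1" using c False by (cases "c = 1") auto
        ultimately have "2 \<le> c" by simp
        then have "4 * n * 2 \<le> 4 * n * c" by (rule mult_le_mono2)
        then show False using c k n_pos by linarith
      qed
      then have "(\<Sum>x\<in>UNIV. x ^ (3 * n + k)) = (0 :: 'a)"
        using sum_power_units[of "3 * n + k", where 'a = 'a] card_field by simp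
      then show ?thesis using False by simp
    qed
  qed
  also have "\<dots> = - of_nat ((3 * n) choose n) * (- 1) ^ n" by simp
  finally show ?thesis using 1 by simp
qed

text \<open>Otherwise the left side of \<open>jacobi_in_field\<close> would vanish, and
  \<open>p\<close> would divide the binomial coefficient.\<close>

lemma jacobi_not_dvd:
  assumes p: "prime p" "p = 4 * r + 1" "p ^ m = 4 * n + 1"
  shows "\<not> (int p dvd jac 0 - jac 2 \<and> int p dvd jac 1 - jac 3)"
proof
  assume dvd: "int p dvd jac 0 - jac 2 \<and> int p dvd jac 1 - jac 3"
  have "of_nat (p ^ m) = (0 :: 'a)"
    using of_nat_card_UNIV_eq_0[where 'a = 'a] card_field p by simp
  then have p0: "of_nat p = (0 :: 'a)" by simp
  have "of_int z = (0 :: 'a)" if z: "int p dvd z" for z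
  proof -
    obtain k where "z = int p * k" using z by (rule dvdE)
    then show ?thesis using p0 by simp
  qed
  then have "of_nat ((3 * n) choose n) = (0 :: 'a)"
    using jacobi_in_field dvd by (simp del: of_int_diff)
  then have "CHAR('a) dvd (3 * n) choose n" by (simp add: of_nat_eq_0_iff_char_dvd)
  moreover have "CHAR('a) dvd p" using p0 by (simp add: of_nat_eq_0_iff_char_dvd)
  moreover have "CHAR('a) \<noteq> 1" by (metis of_nat_CHAR of_nat_1 zero_neq_one)
  ultimately have "p dvd (3 * n) choose n"
    using p(1) by (metis prime_nat_iff)
  then show False
    using prime_not_dvd_choose_three[OF p(1,2) p(3)[symmetric]] by simp
qed

end

section \<open>The spectrum, connectedness and common neighbours\<close>

lemma proots_prod_linear_factors: "proots (\<Prod>a\<leftarrow>xs. [:- a, 1:]) = mset (xs :: complex list)"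
proof (induction xs)
  case (Cons a xs)
  have "(\<Prod>a\<leftarrow>xs. [:- a, 1:]) \<noteq> 0" by (auto simp: prod_list_zero_iff)
  then have "proots ([:- a, 1:] * (\<Prod>a\<leftarrow>xs. [:- a, 1:])) = proots [:- a, 1:] + proots (\<Prod>a\<leftarrow>xs. [:- a, 1:])"
    by (intro proots_mult) simp_all
  then show ?case using Cons by simp
qed simp

lemma sum_nth_UNIV:
  assumes "distinct vs" "set vs = UNIV"
  shows "(\<Sum>k = 0..<length vs. F (vs ! k)) = (\<Sum>x\<in>UNIV. F x)"
proof (rule sum.reindex_bij_betw)
  show "bij_betw ((!) vs) {0..<length vs} UNIV"
    using bij_betw_nth[OF assms(1), of "{0..<length vs}" UNIV] assms(2) by (simp add: atLeast0LessThan)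
qed

section \<open>Diagonalising Cayley matrices by characters\<close>

context additive_char
begin

text \<open>The columns of \<open>V\<close> are the characters
  \<open>x \<mapsto> \<psi> (x * b)\<close>, which are eigenvectors of every Cayley matrix of the
  additive group; orthogonality makes \<open>W\<close> the inverse of \<open>V\<close>.\<close>

lemma char_poly_cayley:
  fixes R :: "'a set" and vs :: "'a list"
  assumes vs: "distinct vs" "set vs = UNIV"
  defines "N \<equiv> length vs"
  defines "A \<equiv> mat N N (\<lambda>(i, j). if vs ! j - vs ! i \<in> R then 1 else 0 :: complex)"
  defines "ev \<equiv> \<lambda>b. \<Sum>x\<in>R. \<psi> (b * x)"
  shows "char_poly A = (\<Prod>a\<leftarrow>map ev vs. [:- a, 1:])"
proof -
  have N: "N = CARD('a)"
    using distinct_card[OF vs(1)] vs(2) by (simp add: N_def)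
  define V where "V = mat N N (\<lambda>(i, j). \<psi> (vs ! i * vs ! j))"
  define W where "W = mat N N (\<lambda>(i, j). \<psi> (- (vs ! i * vs ! j)) / of_nat CARD('a))"
  define D where "D = mat N N (\<lambda>(i, j). if i = j then ev (vs ! i) else 0)"
  have carr: "A \<in> carrier_mat N N" "V \<in> carrier_mat N N" "W \<in> carrier_mat N N" "D \<in> carrier_mat N N"
    by (auto simp: A_def V_def W_def D_def)
  have nth_eq: "vs ! i = vs ! j \<longleftrightarrow> i = j" if "i < N" "j < N" for i j
    using that vs(1) by (simp add: N_def nth_eq_iff_index_eq)
  have VW: "V * W = 1\<^sub>m N"
  proof (rule eq_matI)
    fix i j assume "i < dim_row (1\<^sub>m N)" "j < dim_col (1\<^sub>m N)"
    then have ij: "i < N" "j < N" by auto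
    have "(V * W) $$ (i, j) = (\<Sum>k = 0..<N. \<psi> (vs ! i * vs ! k) * (\<psi> (- (vs ! k * vs ! j)) / of_nat CARD('a)))"
      using ij carr by (simp add: scalar_prod_def V_def W_def)
    also have "\<dots> = (\<Sum>x\<in>UNIV. \<psi> (vs ! i * x) * (\<psi> (- (x * vs ! j)) / of_nat CARD('a)))"
      unfolding N_def by (rule sum_nth_UNIV[OF vs])
    also have "\<dots> = (\<Sum>x\<in>UNIV. \<psi> ((vs ! i - vs ! j) * x)) / of_nat CARD('a)"
      unfolding sum_divide_distrib
    proof (rule sum.cong[OF refl])
      fix x
      have "(vs ! i - vs ! j) * x = vs ! i * x + - (x * vs ! j)" by (simp add: algebra_simps)
      then show "\<psi> (vs ! i * x) * (\<psi> (- (x * vs ! j)) / of_nat CARD('a)) =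
          \<psi> ((vs ! i - vs ! j) * x) / of_nat CARD('a)"
        by (simp only: psi_add times_divide_eq_right)
    qed
    also have "\<dots> = (if i = j then 1 else 0)"
      using psi_sum[of "vs ! i - vs ! j"] nth_eq[OF ij] by simp
    also have "\<dots> = 1\<^sub>m N $$ (i, j)" using ij by simp
    finally show "(V * W) $$ (i, j) = 1\<^sub>m N $$ (i, j)" .
  qed (use carr in auto)
  have WV: "W * V = 1\<^sub>m N"
    by (rule mat_mult_left_right_inverse[OF carr(2,3) VW])
  have AV: "A * V = V * D"
  proof (rule eq_matI)
    fix i j assume "i < dim_row (V * D)" "j < dim_col (V * D)"
    then have ij: "i < N" "j < N" using carr by auto
    have "(A * V) $$ (i, j) = (\<Sum>k = 0..<N. (if vs ! k - vs ! i \<in> R then 1 else 0) * \<psi> (vs ! k * vs ! j))"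
      using ij carr by (simp add: scalar_prod_def A_def V_def)
    also have "\<dots> = (\<Sum>x\<in>UNIV. (if x - vs ! i \<in> R then 1 else 0) * \<psi> (x * vs ! j))"
      unfolding N_def by (rule sum_nth_UNIV[OF vs])
    also have "\<dots> = (\<Sum>x\<in>UNIV. if x - vs ! i \<in> R then \<psi> (x * vs ! j) else 0)"
      by (intro sum.cong refl) simp
    also have "\<dots> = (\<Sum>x | x - vs ! i \<in> R. \<psi> (x * vs ! j))"
      by (simp flip: sum.inter_filter)
    \<comment> \<open>Writing a neighbour as \<open>vs ! i + y\<close> pulls the entry of the
      eigenvector out of the sum.\<close>
    also have "\<dots> = (\<Sum>y\<in>R. \<psi> (vs ! i * vs ! j) * \<psi> (vs ! j * y))"
    proof (rule sum.reindex_bij_witness[of _ "\<lambda>y. vs ! i + y" "\<lambda>x. x - vs ! i"])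
      fix x assume "x \<in> {x. x - vs ! i \<in> R}"
      have "x * vs ! j = vs ! i * vs ! j + vs ! j * (x - vs ! i)" by (simp add: algebra_simps)
      then show "\<psi> (vs ! i * vs ! j) * \<psi> (vs ! j * (x - vs ! i)) = \<psi> (x * vs ! j)"
        by (simp only: psi_add)
    qed auto
    also have "\<dots> = \<psi> (vs ! i * vs ! j) * ev (vs ! j)"
      by (simp only: ev_def sum_distrib_left)
    also have "\<dots> = (\<Sum>k = 0..<N. if k = j then \<psi> (vs ! i * vs ! k) * ev (vs ! k) else 0)"
      using ij by simp
    also have "\<dots> = (\<Sum>k = 0..<N. \<psi> (vs ! i * vs ! k) * (if k = j then ev (vs ! k) else 0))"
      by (intro sum.cong refl) simp
    also have "\<dots> = (V * D) $$ (i, j)"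
      using ij carr by (simp add: scalar_prod_def D_def V_def)
    finally show "(A * V) $$ (i, j) = (V * D) $$ (i, j)" .
  qed (use carr in auto)
  have "A = A * (V * W)" using VW carr by simp
  also have "\<dots> = (A * V) * W" by (rule assoc_mult_mat[symmetric, OF carr(1,2,3)])
  also have "\<dots> = V * D * W" by (simp only: AV)
  finally have "similar_mat A D"
    using carr VW WV by (intro similar_matI[of _ _ V W N]) auto
  then have "char_poly A = char_poly D" by (rule char_poly_similar)
  also have "\<dots> = (\<Prod>a\<leftarrow>diag_mat D. [:- a, 1:])"
    by (rule char_poly_upper_triangular[OF carr(4)]) (auto simp: upper_triangular_def D_def)
  also have "diag_mat D = map ev vs"
    by (rule nth_equalityI) (auto simp: diag_mat_def D_def N_def)
  finally show ?thesis .
qed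

end

section \<open>Adjacency and connectedness\<close>

context quartic_field
begin

lemma parcs_gen_paley: "(v, w) \<in> parcs (gen_paley 4) \<longleftrightarrow> w - v \<in> cls 0"
  by (simp add: gen_paley_def power_residues_4)

lemma pverts_gen_paley [simp]: "pverts (gen_paley 4) = UNIV"
  by (simp add: gen_paley_def)

text \<open>
  The additive span \<open>S\<close> of the fourth powers is a subfield with more than \<open>(q - 1) / 4\<close>
  elements, while a proper subfield satisfies \<open>(card S)\<^sup>2 \<le> q\<close>.
\<close>

lemma connected_gen_paley:
  assumes "n > 2"
  shows "connected (with_proj (gen_paley 4 :: 'a pair_pre_digraph))"
proof -
  define E where "E = parcs (gen_paley 4 :: 'a pair_pre_digraph)"
  have E: "(v, w) \<in> E \<longleftrightarrow> w - v \<in> cls 0" for v w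
    by (simp add: E_def parcs_gen_paley)
  define S where "S = {x. (0, x) \<in> E\<^sup>*}"
  have trans_map: "(f v, f w) \<in> E\<^sup>*" if "(v, w) \<in> E\<^sup>*" "\<And>v w. (v, w) \<in> E \<Longrightarrow> (f v, f w) \<in> E\<^sup>*" for f v w
    using that(1) by induction (auto intro: rtrancl_trans that(2))
  have shift: "(v + a, w + a) \<in> E\<^sup>*" if "(v, w) \<in> E\<^sup>*" for v w a
    by (rule trans_map[OF that, of "\<lambda>v. v + a"]) (rule r_into_rtrancl, simp add: E)
  have scale: "(r * v, r * w) \<in> E\<^sup>*" if "(v, w) \<in> E\<^sup>*" "r \<in> cls 0" for v w r
  proof (rule trans_map[OF that(1), of "\<lambda>v. r * v"])
    fix v w assume "(v, w) \<in> E"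
    then have "r * (w - v) \<in> cls 0" using cls_mult[OF that(2), of "w - v" 0] by (simp add: E)
    then show "(r * v, r * w) \<in> E\<^sup>*" by (intro r_into_rtrancl) (simp add: E right_diff_distrib)
  qed
  have S_add: "x + y \<in> S" if "x \<in> S" "y \<in> S" for x y
    using that shift[of 0 y x] by (auto simp: S_def add.commute)
  have S_0: "0 \<in> S" by (simp add: S_def)
  have S_R: "x \<in> S" if "x \<in> cls 0" for x
    using that by (auto simp: S_def E)
  have S_scale: "r * x \<in> S" if "r \<in> cls 0" "x \<in> S" for r x
    using scale[of 0 x r] that by (simp add: S_def)
  \<comment> \<open>Every edge of a path from 0 to \<open>y\<close> adds a fourth power, and fourth
    powers map \<open>S\<close> into itself.\<close>
  have S_mult: "x * y \<in> S" if "x \<in> S" "y \<in> S" for x y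
  proof -
    have "(0, y) \<in> E\<^sup>*" using that by (simp add: S_def)
    then show ?thesis
    proof induction
      case (step y z)
      then have "(z - y) * x \<in> S" using S_scale that(1) by (simp add: E)
      then have "x * y + (z - y) * x \<in> S" by (rule S_add[OF step.IH])
      then show ?case by (simp add: algebra_simps)
    qed (simp add: S_0)
  qed
  have S_uminus: "- x \<in> S" if "x \<in> S" for x
    using S_scale[OF minus_one_cls that] by simp
  have S_diff: "x - y \<in> S" if "x \<in> S" "y \<in> S" for x y
    using S_add[OF that(1) S_uminus[OF that(2)]] by simp
  have S_1: "1 \<in> S" by (rule S_R) (simp add: cls_def)
  have S_pow: "x ^ k \<in> S" if "x \<in> S" for x k
    by (induction k) (simp_all add: S_1 S_mult that)
  have S_inverse: "inverse x \<in> S" if "x \<in> S" "x \<noteq> 0" for x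
  proof -
    have "x * x ^ (4 * n - 1) = x ^ (4 * n)" using n_pos by (simp flip: power_Suc)
    also have "\<dots> = 1" using power_card_minus_1[OF that(2)] card_field by simp
    finally have "inverse x = x ^ (4 * n - 1)" by (rule inverse_unique)
    then show ?thesis using S_pow[OF that(1)] by simp
  qed
  have "insert 0 (cls 0) \<subseteq> S" using S_0 S_R by auto
  then have card_S: "n + 1 \<le> card S"
    using card_mono[of S "insert 0 (cls 0)"] by (simp add: card_cls)
  have "S = UNIV"
  proof (rule ccontr)
    assume "S \<noteq> UNIV"
    then obtain v where v: "v \<notin> S" by auto
    \<comment> \<open>If two pairs collided, solving for \<open>v\<close> would place it in the
      subfield \<open>S\<close>.\<close>
    have "inj_on (\<lambda>(x, y). x + v * y) (S \<times> S)"
    proof (rule inj_onI, clarify)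
      fix x y x' y' assume *: "x \<in> S" "y \<in> S" "x' \<in> S" "y' \<in> S" "x + v * y = x' + v * y'"
      have eq: "v * (y - y') = x' - x" using *(5) by (simp add: algebra_simps)
      have "y = y'"
      proof (rule ccontr)
        assume "y \<noteq> y'"
        then have ne: "y - y' \<noteq> 0" by simp
        then have "v = (x' - x) * inverse (y - y')" using eq by (simp add: field_simps)
        moreover have "\<dots> \<in> S" by (intro S_mult S_diff S_inverse * ne)
        ultimately show False using v by simp
      qed
      then show "x = x' \<and> y = y'" using eq by simp
    qed
    then have "card (S \<times> S) \<le> CARD('a)" by (rule card_inj_on_le) auto
    then have "card S * card S \<le> 4 * n + 1" using card_field by (simp add: card_cartesian_product)
    moreover have "(n + 1) * (n + 1) \<le> card S * card S" using card_S by (intro mult_mono) auto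
    \<comment> \<open>The inequality amounts to \<open>n \<le> 2\<close>; for even \<open>n\<close>
      this leaves only the field of 9 elements, which the assumption excludes.\<close>
    ultimately have "(n + 1) * (n + 1) \<le> 4 * n + 1" by linarith
    then have "n * n \<le> 2 * n" by simp
    then show False using assms by simp
  qed
  then have reach: "(u, v) \<in> E\<^sup>*" for u v
  proof -
    have "v - u \<in> S" using \<open>S = UNIV\<close> by simp
    then show ?thesis using shift[of 0 "v - u" u] by (simp add: S_def)
  qed
  have "(u, v) \<in> rtrancl_on UNIV (symcl E)" for u v
    using reach[of u v]
  proof induction
    case (step y z)
    then show ?case by (auto simp: symcl_def intro: rtrancl_on_into_rtrancl_on)
  qed simp
  then show ?thesis by (simp add: connected_conv E_def)
qed

end

section \<open>Spectrum and common neighbours in terms of the periods\<close>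

context quartic_gauss
begin

text \<open>The eigenvalue of the character with parameter \<open>b\<close> depends only on the
  class of \<open>b\<close>; the parameter 0 gives the degree \<open>n\<close>.\<close>

lemma graph_spectrum_gen_paley:
  fixes vs :: "'a list"
  assumes vs: "distinct vs" "set vs = UNIV"
  shows "graph_spectrum vs (gen_paley 4) =
    {#of_nat n#} + replicate_mset n (\<eta> 0) + replicate_mset n (\<eta> 1) +
      replicate_mset n (\<eta> 2) + replicate_mset n (\<eta> 3)"
proof -
  define ev where "ev = (\<lambda>b. \<Sum>x\<in>cls 0. \<psi> (b * x))"
  have "adjacency_matrix vs (gen_paley 4) =
      mat (length vs) (length vs) (\<lambda>(i, j). if vs ! j - vs ! i \<in> cls 0 then 1 else 0)"
    by (simp add: adjacency_matrix_def parcs_gen_paley)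
  then have "graph_spectrum vs (gen_paley 4) = mset (map ev vs)"
    unfolding graph_spectrum_def ev_def
    by (simp only: char_poly_cayley[OF vs] proots_prod_linear_factors)
  also have "\<dots> = image_mset ev (mset_set UNIV)"
    using mset_set_set[OF vs(1)] vs(2) by simp
  also have "mset_set (UNIV :: 'a set) = {#0#} + (\<Sum>j<4. mset_set (cls j))"
  proof (rule multiset_eqI)
    fix x :: 'a
    show "count (mset_set UNIV) x = count ({#0#} + (\<Sum>j<4. mset_set (cls j))) x"
    proof (cases "x = 0")
      case True
      then show ?thesis by (simp add: count_sum)
    next
      case False
      then obtain k where k: "k < 4" "x \<in> cls k" using in_cls_cases by metis
      have "x \<in> cls j \<longleftrightarrow> j = k" if "j < 4" for j
        using k that cls_unique[of x j k] by auto
      then have "count (mset_set (cls j)) x = (if j = k then 1 else 0)" if "j < 4" for j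
        using that by (simp add: count_mset_set')
      then have "(\<Sum>j<4. count (mset_set (cls j)) x) = (\<Sum>j<4. if j = k then 1 else 0)"
        by (intro sum.cong refl) simp
      then show ?thesis using k False by (simp add: count_sum)
    qed
  qed
  also have "image_mset ev \<dots> = {#ev 0#} + (\<Sum>j<4. image_mset ev (mset_set (cls j)))"
    by (simp add: eval_nat_numeral)
  also have "ev 0 = of_nat n"
    by (simp add: ev_def psi_0 card_cls)
  also have "(\<Sum>j<4. image_mset ev (mset_set (cls j))) = (\<Sum>j<4. replicate_mset n (\<eta> j))"
  proof (rule sum.cong[OF refl])
    fix j
    have "image_mset ev (mset_set (cls j)) = image_mset (\<lambda>_. \<eta> j) (mset_set (cls j))"
      by (rule image_mset_cong) (use sum_psi_cls[of _ j 0] in \<open>simp add: ev_def\<close>)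
    then show "image_mset ev (mset_set (cls j)) = replicate_mset n (\<eta> j)"
      by (simp add: image_mset_const_eq card_cls)
  qed
  finally show ?thesis by (simp add: eval_nat_numeral)
qed

text \<open>A common neighbour is a solution of \<open>x - y + (u - v) = 0\<close> in fourth powers.
  Solutions are detected by orthogonality, and sorting the parameter \<open>b\<close> by classes
  produces the periods.\<close>

lemma card_common_neighbours:
  assumes uv: "u - v \<in> cls k"
  shows "of_nat (4 * n + 1) * of_nat (card (common_neighbours (gen_paley 4) u v)) =
    (of_nat n)\<^sup>2 + (\<Sum>j<4. (\<eta> j)\<^sup>2 * \<eta> (j + k))"
proof -
  let ?N = "{w. w - u \<in> cls 0 \<and> w - v \<in> cls 0}"
  define ev where "ev = (\<lambda>b. \<Sum>x\<in>cls 0. \<psi> (b * x))"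
  have "common_neighbours (gen_paley 4) u v = ?N"
    by (simp add: common_neighbours_def parcs_gen_paley)
  moreover have "of_nat (card ?N) = (\<Sum>x\<in>cls 0. \<Sum>y\<in>cls 0. if x - y + (u - v) = 0 then 1 else 0 :: complex)"
  proof -
    have "(\<Sum>y\<in>cls 0. if x - y + (u - v) = 0 then 1 else 0 :: complex) =
        (if x + (u - v) \<in> cls 0 then 1 else 0)" for x
    proof -
      have "(\<Sum>y\<in>cls 0. if x - y + (u - v) = 0 then 1 else 0 :: complex) =
          (\<Sum>y\<in>cls 0. if y = x + (u - v) then 1 else 0)"
        by (intro sum.cong refl) (auto simp: algebra_simps)
      then show ?thesis by simp
    qed
    then have "(\<Sum>x\<in>cls 0. \<Sum>y\<in>cls 0. if x - y + (u - v) = 0 then 1 else 0 :: complex) =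
        of_nat (card {x\<in>cls 0. x + (u - v) \<in> cls 0})"
      by (simp flip: sum.inter_filter)
    also have "card {x\<in>cls 0. x + (u - v) \<in> cls 0} = card ?N"
      by (rule bij_betw_same_card[of "\<lambda>x. x + u"], rule bij_betw_byWitness[of _ "\<lambda>w. w - u"])
        (auto simp: algebra_simps)
    finally show ?thesis by simp
  qed
  moreover have "of_nat (4 * n + 1) * (\<Sum>x\<in>cls 0. \<Sum>y\<in>cls 0. if x - y + (u - v) = 0 then 1 else 0 :: complex) =
      (\<Sum>x\<in>cls 0. \<Sum>y\<in>cls 0. \<Sum>b\<in>UNIV. \<psi> (b * x) * \<psi> (b * (- y)) * \<psi> (b * (u - v)))"
    unfolding sum_distrib_left
  proof (intro sum.cong refl)
    fix x y
    have "(\<Sum>b\<in>UNIV. \<psi> (b * x) * \<psi> (b * (- y)) * \<psi> (b * (u - v))) =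
        (\<Sum>b\<in>UNIV. \<psi> ((x - y + (u - v)) * b))"
    proof (rule sum.cong[OF refl])
      fix b
      have "(x - y + (u - v)) * b = b * x + b * (- y) + b * (u - v)" by (simp add: algebra_simps)
      then show "\<psi> (b * x) * \<psi> (b * (- y)) * \<psi> (b * (u - v)) = \<psi> ((x - y + (u - v)) * b)"
        by (simp only: psi_add)
    qed
    also have "\<dots> = of_nat (4 * n + 1) * (if x - y + (u - v) = 0 then 1 else 0)"
      by (simp add: psi_sum card_field)
    finally show "of_nat (4 * n + 1) * (if x - y + (u - v) = 0 then 1 else 0) =
      (\<Sum>b\<in>UNIV. \<psi> (b * x) * \<psi> (b * (- y)) * \<psi> (b * (u - v)))" ..
  qed
  moreover have "(\<Sum>x\<in>cls 0. \<Sum>y\<in>cls 0. \<Sum>b\<in>UNIV. \<psi> (b * x) * \<psi> (b * (- y)) * \<psi> (b * (u - v))) =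
      (\<Sum>b\<in>UNIV. (ev b)\<^sup>2 * \<psi> (b * (u - v)))"
  proof -
    have neg: "(\<Sum>y\<in>cls 0. \<psi> (b * (- y))) = ev b" for b
      unfolding ev_def
      by (rule sum.reindex_bij_witness[of _ uminus uminus]) (auto simp: minus_in_cls_iff)
    have "(\<Sum>x\<in>cls 0. \<Sum>y\<in>cls 0. \<Sum>b\<in>UNIV. \<psi> (b * x) * \<psi> (b * (- y)) * \<psi> (b * (u - v))) =
        (\<Sum>x\<in>cls 0. \<Sum>b\<in>UNIV. \<Sum>y\<in>cls 0. \<psi> (b * x) * \<psi> (b * (- y)) * \<psi> (b * (u - v)))"
      by (intro sum.cong refl sum.swap)
    also have "\<dots> = (\<Sum>b\<in>UNIV. \<Sum>x\<in>cls 0. \<Sum>y\<in>cls 0. \<psi> (b * x) * \<psi> (b * (- y)) * \<psi> (b * (u - v)))"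
      by (rule sum.swap)
    also have "\<dots> = (\<Sum>b\<in>UNIV. (\<Sum>x\<in>cls 0. \<psi> (b * x)) * (\<Sum>y\<in>cls 0. \<psi> (b * (- y))) * \<psi> (b * (u - v)))"
      by (simp only: sum_product) (simp only: sum_distrib_right)
    finally show ?thesis by (simp only: neg power2_eq_square) (simp only: ev_def)
  qed
  moreover have "(\<Sum>b\<in>UNIV. (ev b)\<^sup>2 * \<psi> (b * (u - v))) =
      (ev 0)\<^sup>2 * \<psi> (0 * (u - v)) + (\<Sum>j<4. \<Sum>b\<in>cls j. (ev b)\<^sup>2 * \<psi> (b * (u - v)))"
    by (rule sum_cls)
  moreover have "ev 0 = of_nat n"
    by (simp add: ev_def psi_0 card_cls)
  moreover have "(\<Sum>b\<in>cls j. (ev b)\<^sup>2 * \<psi> (b * (u - v))) = (\<eta> j)\<^sup>2 * \<eta> (j + k)" for j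
  proof -
    have "(\<Sum>b\<in>cls j. (ev b)\<^sup>2 * \<psi> (b * (u - v))) = (\<Sum>b\<in>cls j. (\<eta> j)\<^sup>2 * \<psi> ((u - v) * b))"
      by (intro sum.cong refl) (use sum_psi_cls[of _ j 0] in \<open>simp add: ev_def mult.commute\<close>)
    also have "\<dots> = (\<eta> j)\<^sup>2 * \<eta> (k + j)"
      using sum_psi_cls[OF uv, of j] by (simp flip: sum_distrib_left)
    finally show ?thesis by (simp add: add.commute)
  qed
  ultimately show ?thesis by (simp add: psi_0 del: of_nat_add of_nat_mult)
qed

text \<open>The number of common neighbours depends only on the class of \<open>u - v\<close>. Class
  0 gives the adjacent pairs, and the hypothesis makes the other three classes agree.\<close>

lemma strongly_regular_gen_paley:
  assumes "\<And>k. k \<in> {1, 2, 3} \<Longrightarrow> (\<Sum>j<4. (\<eta> j)\<^sup>2 * \<eta> (j + k)) = c"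
  shows "strongly_regular (gen_paley 4 :: 'a pair_pre_digraph)"
proof -
  let ?G = "gen_paley 4 :: 'a pair_pre_digraph"
  have cn: "card (common_neighbours ?G u v) = card (common_neighbours ?G u' v')"
    if "u - v \<in> cls k" "u' - v' \<in> cls k'"
      "(\<Sum>j<4. (\<eta> j)\<^sup>2 * \<eta> (j + k)) = (\<Sum>j<4. (\<eta> j)\<^sup>2 * \<eta> (j + k'))" for u v u' v' k k'
  proof -
    have "of_nat (4 * n + 1) * of_nat (card (common_neighbours ?G u v)) =
        (of_nat (4 * n + 1) * of_nat (card (common_neighbours ?G u' v')) :: complex)"
      using card_common_neighbours[OF that(1)] card_common_neighbours[OF that(2)] that(3) by metis
    then show ?thesis
      by (simp only: mult_cancel_left of_nat_eq_iff of_nat_eq_0_iff) simp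
  qed
  have sym: "(v, u) \<in> parcs ?G \<longleftrightarrow> u - v \<in> cls 0" for u v
    by (rule parcs_gen_paley)
  have sym': "(u, v) \<in> parcs ?G \<longleftrightarrow> u - v \<in> cls 0" for u v
    using minus_in_cls_iff[of "u - v" 0] by (simp add: parcs_gen_paley)
  obtain g where g: "g \<in> cls 1" using cls_nonempty by blast
  have one: "1 \<in> cls 0" by (simp add: cls_def)
  have "pair_graph ?G"
  proof
    show "finite (parcs ?G)" by (rule finite_subset[of _ UNIV]) auto
    show "symmetric (with_proj ?G)"
      unfolding symmetric_def with_proj_simps by (rule symI) (use sym sym' in blast)
    show "fst e \<noteq> snd e" if "e \<in> parcs ?G" for e
      using that by (cases e) (auto simp: sym')
  qed auto
  moreover have "parcs ?G \<noteq> {}"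
    using one sym'[of 1 0] by auto
  moreover have "\<exists>u\<in>pverts ?G. \<exists>v\<in>pverts ?G. u \<noteq> v \<and> (u, v) \<notin> parcs ?G"
  proof -
    have "g \<notin> cls 0" using g cls_unique[of g 0 1] by auto
    moreover have "g \<noteq> 0" using g by auto
    ultimately show ?thesis using sym'[of g 0] by (intro bexI[of _ g] bexI[of _ 0]) auto
  qed
  moreover have "out_degree (with_proj ?G) v = n" for v
  proof -
    have "out_arcs (with_proj ?G) v = (\<lambda>x. (v, v + x)) ` cls 0"
      by (force simp: out_arcs_def parcs_gen_paley image_iff)
    moreover have "inj_on (\<lambda>x. (v, v + x)) (cls 0)" by (auto simp: inj_on_def)
    ultimately show ?thesis by (simp add: out_degree_def card_image card_cls)
  qed
  moreover have "card (common_neighbours ?G u v) = card (common_neighbours ?G 1 0)"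
    if "(u, v) \<in> parcs ?G" for u v
    by (rule cn[of _ _ 0 _ _ 0]) (use that one in \<open>simp_all add: sym'\<close>)
  moreover have "card (common_neighbours ?G u v) = card (common_neighbours ?G g 0)"
    if "u \<noteq> v" "(u, v) \<notin> parcs ?G" for u v
  proof -
    have "u - v \<noteq> 0" using that by simp
    then obtain k where k: "k < 4" "u - v \<in> cls k" using in_cls_cases by blast
    have "k \<noteq> 0" using k that sym'[of u v] by (cases "k = 0") auto
    with k have "k \<in> {1, 2, 3}" by auto
    then have "(\<Sum>j<4. (\<eta> j)\<^sup>2 * \<eta> (j + k)) = (\<Sum>j<4. (\<eta> j)\<^sup>2 * \<eta> (j + 1))"
      by (intro trans[OF assms assms[of 1, symmetric]]) simp_all
    then show ?thesis
      by (rule cn[OF k(2), rotated]) (use g in simp)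
  qed
  ultimately show ?thesis
    unfolding strongly_regular_def by blast
qed

end

section \<open>Sums of two squares\<close>

text \<open>If \<open>p\<close> did not divide \<open>x\<close>, it would not divide
  \<open>y\<close> either, and raising \<open>x\<^sup>2 = - (y\<^sup>2)\<close> modulo
  \<open>p\<close> to the odd exponent \<open>(p - 1) div 2\<close> would give
  \<open>1 = - 1\<close> by Fermat.\<close>

lemma prime_3_mod_4_dvd_sum_squares:
  fixes x y :: int
  assumes p: "prime p" "[p = 3] (mod 4)" and dvd: "int p dvd x\<^sup>2 + y\<^sup>2"
  shows "int p dvd x \<and> int p dvd y"
proof -
  have pi: "prime (int p)" using p(1) by simp
  have dvd_x: "int p dvd x" if dvd: "int p dvd x\<^sup>2 + y\<^sup>2" for x y
  proof (rule ccontr)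
    assume x: "\<not> int p dvd x"
    obtain r where r: "p = 4 * r + 3"
    proof -
      have "p mod 4 = 3" using p(2) by (simp add: cong_def)
      then have "p = 4 * (p div 4) + 3" by presburger
      then show ?thesis using that by blast
    qed
    have fermat: "[z ^ (p - 1) = 1] (mod int p)" if "\<not> int p dvd z" for z :: int
    proof -
      have "\<not> int p dvd int (nat \<bar>z\<bar>)" using that by simp
      then have "\<not> p dvd nat \<bar>z\<bar>" by (simp only: int_dvd_int_iff not_False_eq_True)
      then have "[nat \<bar>z\<bar> ^ (p - 1) = 1] (mod p)" by (rule fermat_little[OF p(1)])
      then have "[\<bar>z\<bar> ^ (p - 1) = 1] (mod int p)"
        by (metis cong_int_iff int_nat_eq abs_ge_zero of_nat_1 of_nat_power)
      moreover have "even (p - 1)" using r by simp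
      ultimately show ?thesis by (simp add: power_even_abs)
    qed
    have y: "\<not> int p dvd y"
    proof
      assume "int p dvd y"
      then have "int p dvd y\<^sup>2" by (simp add: power2_eq_square)
      then have "int p dvd x\<^sup>2" using dvd by (simp add: dvd_add_left_iff)
      then show False using x prime_dvd_power[OF pi] by blast
    qed
    have "[x\<^sup>2 = - (y\<^sup>2)] (mod int p)"
      using dvd by (simp add: cong_iff_dvd_diff)
    then have "[(x\<^sup>2) ^ (2 * r + 1) = (- (y\<^sup>2)) ^ (2 * r + 1)] (mod int p)"
      by (rule cong_pow)
    moreover have "(x\<^sup>2) ^ (2 * r + 1) = x ^ (p - 1)"
      by (simp only: r flip: power_mult) (simp add: algebra_simps)
    moreover have "(- (y\<^sup>2)) ^ (2 * r + 1) = - ((y\<^sup>2) ^ (2 * r + 1))"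
      by (rule power_minus_odd) simp
    moreover have "(y\<^sup>2) ^ (2 * r + 1) = y ^ (p - 1)"
      by (simp only: r flip: power_mult) (simp add: algebra_simps)
    ultimately have "[x ^ (p - 1) = - (y ^ (p - 1))] (mod int p)" by simp
    moreover have "[- (y ^ (p - 1)) = - 1] (mod int p)"
      using fermat[OF y] by (simp only: cong_minus_minus_iff)
    ultimately have "[1 = - 1] (mod int p)"
      using fermat[OF x] by (meson cong_sym cong_trans)
    then have "int p dvd 2" by (simp add: cong_iff_dvd_diff)
    then have "p \<le> 2" by (auto dest: zdvd_imp_le)
    then show False using r by simp
  qed
  show ?thesis using dvd_x[OF dvd] dvd_x[of y x] dvd by (simp add: add.commute)
qed

text \<open>Descent: both numbers are divisible by \<open>p\<close>, which is divided out until the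
  sum of squares is 1.\<close>

lemma sum_squares_prime_power_3_mod_4:
  fixes x y :: int
  assumes p: "prime p" "[p = 3] (mod 4)" and "x\<^sup>2 + y\<^sup>2 = (int p ^ k)\<^sup>2"
  shows "x = 0 \<or> y = 0"
  using assms(3)
proof (induction k arbitrary: x y)
  case 0
  then have "x\<^sup>2 + y\<^sup>2 = 1" by simp
  show ?case
  proof (rule ccontr)
    assume "\<not> ?thesis"
    then have "0 < x\<^sup>2" "0 < y\<^sup>2" by auto
    with \<open>x\<^sup>2 + y\<^sup>2 = 1\<close> show False by linarith
  qed
next
  case (Suc k)
  have "int p dvd x\<^sup>2 + y\<^sup>2" unfolding Suc.prems by (simp add: power2_eq_square)
  then obtain x' y' where xy: "x = int p * x'" "y = int p * y'"
    using prime_3_mod_4_dvd_sum_squares[OF p] by (meson dvdE)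
  have "(int p)\<^sup>2 * (x'\<^sup>2 + y'\<^sup>2) = (int p)\<^sup>2 * (int p ^ k)\<^sup>2"
    using Suc.prems by (simp add: xy power_mult_distrib distrib_left)
  moreover have "(int p)\<^sup>2 \<noteq> 0" using p(1) by auto
  ultimately have "x'\<^sup>2 + y'\<^sup>2 = (int p ^ k)\<^sup>2" by simp
  then show ?case using Suc.IH[of x' y'] xy by auto
qed

text \<open>With \<open>X = c * d' - c' * d\<close> and \<open>Y = c * d' + c' * d\<close>,
  \<open>N\<close> divides \<open>X * Y\<close> while \<open>p\<close> divides at most one factor,
  so \<open>N\<close> divides one of them. Brahmagupta's identity bounds that factor and forces it
  to be 0; the congruences modulo 4 fix the sign of \<open>c\<close>.\<close>

lemma primitive_rep_unique:
  fixes c d c' d' :: int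
  assumes p: "prime (int p)" "odd p" and N: "N = int p ^ k" "k > 0"
    and rep: "c\<^sup>2 + 4 * d\<^sup>2 = N" "c'\<^sup>2 + 4 * d'\<^sup>2 = N"
    and mod4: "[c = 1] (mod 4)" "[c' = 1] (mod 4)"
    and cop: "\<not> int p dvd c" "\<not> int p dvd c'"
  shows "c' = c \<and> (d' = d \<or> d' = - d)"
proof -
  have Npos: "N > 0" using p(1) N by (simp add: prime_gt_0_nat)
  have c0: "c \<noteq> 0" using cop by auto
  \<comment> \<open>Stated for every \<open>d'\<close>, because replacing \<open>d'\<close> by
    \<open>- d'\<close> reduces the case of \<open>Y\<close> to that of \<open>X\<close>.\<close>
  have key: "c' = c \<and> d' = d" if rep': "c'\<^sup>2 + 4 * d'\<^sup>2 = N" and X: "N dvd c * d' - c' * d" for d'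
  proof -
    define X where "X = c * d' - c' * d"
    have "N\<^sup>2 = (c\<^sup>2 + 4 * d\<^sup>2) * (c'\<^sup>2 + 4 * d'\<^sup>2)"
      by (simp only: rep(1) rep' power2_eq_square[of N])
    also have "\<dots> = (c * c' + 4 * d * d')\<^sup>2 + 4 * X\<^sup>2"
      by (simp add: X_def power2_eq_square algebra_simps)
    finally have "4 * X\<^sup>2 \<le> N\<^sup>2" by simp
    have "X = 0"
    proof (rule ccontr)
      assume "X \<noteq> 0"
      then have "N \<le> \<bar>X\<bar>" using X Npos by (metis X_def dvd_abs_iff zdvd_imp_le zero_less_abs_iff)
      then have "N\<^sup>2 \<le> X\<^sup>2" using Npos by (metis abs_le_square_iff abs_of_pos)
      moreover have "N\<^sup>2 > 0" using Npos by simp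
      ultimately show False using \<open>4 * X\<^sup>2 \<le> N\<^sup>2\<close> by linarith
    qed
    then have eq: "c * d' = c' * d" by (simp add: X_def)
    have "c\<^sup>2 * N = (c * c')\<^sup>2 + 4 * (c * d')\<^sup>2"
      by (simp only: rep'[symmetric]) (simp add: power2_eq_square algebra_simps)
    also have "\<dots> = c'\<^sup>2 * (c\<^sup>2 + 4 * d\<^sup>2)"
      unfolding eq by (simp add: power2_eq_square algebra_simps)
    finally have "c\<^sup>2 = c'\<^sup>2" using rep(1) Npos by simp
    then have "c' = c \<or> c' = - c" by (auto simp: power2_eq_iff)
    moreover have "c' \<noteq> - c"
    proof
      assume "c' = - c"
      then have "[- c = 1] (mod 4)" using mod4(2) by simp
      then have "(- c) mod 4 = 1" "c mod 4 = 1" using mod4(1) by (simp_all add: cong_def)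
      then show False by presburger
    qed
    ultimately have "c' = c" by simp
    then show ?thesis using eq c0 by simp
  qed
  let ?X = "c * d' - c' * d" and ?Y = "c * d' + c' * d"
  have "4 * (?X * ?Y) = c\<^sup>2 * (4 * d'\<^sup>2) - c'\<^sup>2 * (4 * d\<^sup>2)"
    by (simp add: power2_eq_square algebra_simps)
  also have "4 * d'\<^sup>2 = N - c'\<^sup>2" using rep(2) by simp
  also have "4 * d\<^sup>2 = N - c\<^sup>2" using rep(1) by simp
  also have "c\<^sup>2 * (N - c'\<^sup>2) - c'\<^sup>2 * (N - c\<^sup>2) = N * (c\<^sup>2 - c'\<^sup>2)"
    by (simp add: algebra_simps)
  finally have "N dvd 4 * (?X * ?Y)" by simp
  moreover have "coprime N 4"
  proof -
    have "coprime N 2" using p(2) N by simp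
    then have "coprime N (2 * 2)" by (simp only: coprime_mult_right_iff)
    then show ?thesis by simp
  qed
  ultimately have XY: "N dvd ?X * ?Y" by (simp add: coprime_dvd_mult_right_iff)
  have not_both: "\<not> (int p dvd ?X \<and> int p dvd ?Y)"
  proof
    assume "int p dvd ?X \<and> int p dvd ?Y"
    then have "int p dvd ?X + ?Y" using dvd_add by blast
    then have "int p dvd 2 * (c * d')" by simp
    moreover have "coprime (int p) 2" using p(2) by simp
    ultimately have "int p dvd c * d'" by (simp add: coprime_dvd_mult_right_iff)
    then have "int p dvd d'" using cop p(1) by (simp add: prime_dvd_mult_iff)
    then have "int p dvd 4 * d'\<^sup>2" by (simp add: power2_eq_square)
    moreover have "int p dvd N" using N by simp
    ultimately have "int p dvd N - 4 * d'\<^sup>2" by (rule dvd_diff[rotated])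
    then have "int p dvd c'\<^sup>2" by (simp flip: rep(2))
    then show False using cop prime_dvd_power[OF p(1)] by blast
  qed
  have "N dvd ?X \<or> N dvd ?Y"
  proof (cases "int p dvd ?X")
    case True
    then have "coprime N ?Y" using not_both p(1) N by (simp add: prime_imp_coprime)
    then show ?thesis using XY by (simp add: coprime_dvd_mult_left_iff)
  next
    case False
    then have "coprime N ?X" using p(1) N by (simp add: prime_imp_coprime)
    then show ?thesis using XY by (simp add: coprime_dvd_mult_right_iff)
  qed
  then show ?thesis
  proof
    assume "N dvd ?X"
    then show ?thesis using key[OF rep(2)] by simp
  next
    assume "N dvd ?Y"
    then have "N dvd c * (- d') - c' * d"
      by (metis add.commute dvd_minus_iff minus_add_distrib mult_minus_right uminus_add_conv_diff diff_conv_add_uminus)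
    then have "c' = c \<and> - d' = d" using key[of "- d'"] rep(2) by simp
    then show ?thesis by auto
  qed
qed

text \<open>
  Here \<open>x + \<i> y\<close> is the quartic Gauss sum and \<open>a + \<i> b\<close> is minus the Jacobi sum.
\<close>

lemma gauss_sum_exact_power:
  fixes x y a b :: int
  assumes p: "prime (int p)" "odd p" and t: "t > 0"
    and norm: "x\<^sup>2 + y\<^sup>2 = int p ^ (4 * t)"
    and sq: "x\<^sup>2 - y\<^sup>2 = a * int p ^ (2 * t)" "2 * x * y = b * int p ^ (2 * t)"
    and ndvd: "\<not> (int p dvd a \<and> int p dvd b)" and "even y"
  shows "\<exists>c d. [c = 1] (mod 4) \<and> \<not> int p dvd c \<and> c\<^sup>2 + 4 * d\<^sup>2 = int p ^ (2 * t) \<and>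
    (x = int p ^ t * c \<or> x = - (int p ^ t * c)) \<and> y = 2 * (int p ^ t * d)"
proof -
  let ?p = "int p"
  have p0: "?p \<noteq> 0" using p by auto
  have cop2: "coprime ?p 2" using p(2) by simp
  \<comment> \<open>As long as \<open>e < t\<close>, \<open>p\<close> divides both the sum and the
    difference of the squares of the cofactors, so another \<open>p\<close> splits off from
    each.\<close>
  have "e \<le> t \<Longrightarrow> \<exists>x' y'. x = ?p ^ e * x' \<and> y = ?p ^ e * y'" for e
  proof (induction e)
    case (Suc e)
    then obtain x' y' where xy: "x = ?p ^ e * x'" "y = ?p ^ e * y'" by auto
    have split: "?p ^ k = (?p ^ e)\<^sup>2 * ?p ^ (k - 2 * e)" if "2 * e \<le> k" for k
      using that by (simp flip: power_mult power_add add: mult.commute)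
    have pe: "(?p ^ e)\<^sup>2 \<noteq> 0" using p0 by simp
    have "(?p ^ e)\<^sup>2 * (x'\<^sup>2 + y'\<^sup>2) = (?p ^ e)\<^sup>2 * ?p ^ (4 * t - 2 * e)"
      using norm split[of "4 * t"] Suc.prems by (simp add: xy power_mult_distrib distrib_left)
    then have 1: "x'\<^sup>2 + y'\<^sup>2 = ?p ^ (4 * t - 2 * e)" by (simp only: mult_left_cancel[OF pe])
    have "(?p ^ e)\<^sup>2 * (x'\<^sup>2 - y'\<^sup>2) = (?p ^ e)\<^sup>2 * (a * ?p ^ (2 * t - 2 * e))"
      using sq(1) split[of "2 * t"] Suc.prems by (simp add: xy power_mult_distrib right_diff_distrib)
    then have 2: "x'\<^sup>2 - y'\<^sup>2 = a * ?p ^ (2 * t - 2 * e)" by (simp only: mult_left_cancel[OF pe])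
    have d1: "?p dvd ?p ^ (4 * t - 2 * e)" "?p dvd a * ?p ^ (2 * t - 2 * e)"
      using Suc.prems by (auto intro!: dvd_mult dvd_power)
    have "?p dvd (x'\<^sup>2 + y'\<^sup>2) + (x'\<^sup>2 - y'\<^sup>2)" "?p dvd (x'\<^sup>2 + y'\<^sup>2) - (x'\<^sup>2 - y'\<^sup>2)"
      unfolding 1 2 using d1 by (intro dvd_add dvd_diff; simp)+
    then have "?p dvd 2 * x'\<^sup>2" "?p dvd 2 * y'\<^sup>2" by simp_all
    then have "?p dvd x'\<^sup>2" "?p dvd y'\<^sup>2"
      using cop2 by (simp_all add: coprime_dvd_mult_right_iff)
    then have "?p dvd x'" "?p dvd y'" using p(1) prime_dvd_power by blast+
    then obtain x'' y'' where "x' = ?p * x''" "y' = ?p * y''" by (meson dvdE)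
    then show ?case using xy by (intro exI[of _ x''] exI[of _ y'']) simp
  qed simp
  then obtain x' y' where xy: "x = ?p ^ t * x'" "y = ?p ^ t * y'" by blast
  have pt: "(?p ^ t)\<^sup>2 = ?p ^ (2 * t)" by (simp flip: power_mult add: mult.commute)
  have p4t: "?p ^ (4 * t) = ?p ^ (2 * t) * ?p ^ (2 * t)" by (simp flip: power_add)
  have pt0: "?p ^ (2 * t) \<noteq> 0" using p0 by simp
  have "?p ^ (2 * t) * (x'\<^sup>2 + y'\<^sup>2) = ?p ^ (2 * t) * ?p ^ (2 * t)"
    using norm by (simp add: xy power_mult_distrib distrib_left pt p4t)
  then have n': "x'\<^sup>2 + y'\<^sup>2 = ?p ^ (2 * t)" by (simp only: mult_left_cancel[OF pt0])
  have "?p ^ (2 * t) * (x'\<^sup>2 - y'\<^sup>2) = ?p ^ (2 * t) * a"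
    using sq(1) by (simp add: xy power_mult_distrib right_diff_distrib pt mult.commute)
  then have a': "x'\<^sup>2 - y'\<^sup>2 = a" by (simp only: mult_left_cancel[OF pt0])
  have "?p ^ (2 * t) * (2 * x' * y') = 2 * x * y"
    by (simp add: xy power2_eq_square flip: pt)
  also have "\<dots> = ?p ^ (2 * t) * b" by (simp add: sq(2))
  finally have b': "2 * x' * y' = b" by (simp only: mult_left_cancel[OF pt0])
  \<comment> \<open>Divisibility of \<open>x'\<close> would spread to \<open>y'\<close> and then to
    \<open>a\<close> and \<open>b\<close>.\<close>
  have nx: "\<not> ?p dvd x'"
  proof
    assume x: "?p dvd x'"
    have "?p dvd ?p ^ (2 * t)" using t by simp
    then have "?p dvd ?p ^ (2 * t) - x'\<^sup>2" using x by (simp add: power2_eq_square)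
    then have "?p dvd y'\<^sup>2" by (simp flip: n')
    then have "?p dvd y'" using p(1) prime_dvd_power by blast
    then have "?p dvd a" "?p dvd b" using x a' b' by (auto simp: power2_eq_square)
    then show False using ndvd by simp
  qed
  have "even y'" using \<open>even y\<close> xy p(2) by simp
  then obtain d where d: "y' = 2 * d" by blast
  have "odd (x'\<^sup>2 + y'\<^sup>2)" unfolding n' using p(2) by simp
  then have "odd x'" using d by simp
  \<comment> \<open>Normalising \<open>c\<close> to be 1 modulo 4 is why \<open>x\<close> is
    obtained only up to sign.\<close>
  then have "x' mod 4 = 1 \<or> (- x') mod 4 = 1" by presburger
  then obtain c where c: "c mod 4 = 1" "c = x' \<or> c = - x'" by blast
  have "[c = 1] (mod 4)" using c by (simp add: cong_def)
  moreover have "\<not> ?p dvd c" using c nx by auto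
  moreover have "c\<^sup>2 + 4 * d\<^sup>2 = ?p ^ (2 * t)" using n' c d by (auto simp: power_mult_distrib)
  ultimately show ?thesis using c xy d by (intro exI[of _ c] exI[of _ d]) auto
qed

text \<open>
  The \<open>h\<close>'s stand for the four Gaussian periods and \<open>a + \<i> b\<close> for the Jacobi sum.
\<close>

definition period_data :: "nat \<Rightarrow> nat \<Rightarrow> int \<Rightarrow> int \<Rightarrow> int \<Rightarrow> int \<Rightarrow> bool" where
  "period_data p q h0 h1 h2 h3 \<longleftrightarrow>
     h0 + h1 + h2 + h3 = - 1 \<and>
     (h0 + h2 - h1 - h3)\<^sup>2 = int q \<and>
     (h0 - h2)\<^sup>2 + (h1 - h3)\<^sup>2 = int q \<and>
     (\<exists>a b. (h0 - h2)\<^sup>2 - (h1 - h3)\<^sup>2 = a * (h0 + h2 - h1 - h3) \<and>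
        2 * (h0 - h2) * (h1 - h3) = b * (h0 + h2 - h1 - h3) \<and>
        ([p = 1] (mod 4) \<longrightarrow> \<not> (int p dvd a \<and> int p dvd b)))"

text \<open>
  A cyclic shift of the periods amounts to replacing \<open>\<psi>\<close> by \<open>\<lambda>x. \<psi> (g * x)\<close> with \<open>g\<close> in the
  first cyclotomic class; it negates the quadratic Gauss sum.
\<close>

lemma period_data_shift:
  assumes "period_data p q h0 h1 h2 h3"
  shows "period_data p q h1 h2 h3 h0"
proof -
  obtain a b where ab: "(h0 - h2)\<^sup>2 - (h1 - h3)\<^sup>2 = a * (h0 + h2 - h1 - h3)"
      "2 * (h0 - h2) * (h1 - h3) = b * (h0 + h2 - h1 - h3)"
      "[p = 1] (mod 4) \<longrightarrow> \<not> (int p dvd a \<and> int p dvd b)"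
    using assms unfolding period_data_def by blast
  have A: "h1 + h3 - h2 - h0 = - (h0 + h2 - h1 - h3)" by simp
  have "(h1 - h3)\<^sup>2 - (h2 - h0)\<^sup>2 = a * (h1 + h3 - h2 - h0)"
    unfolding A mult_minus_right ab(1)[symmetric] by (simp add: power2_commute)
  moreover have "2 * (h1 - h3) * (h2 - h0) = b * (h1 + h3 - h2 - h0)"
    unfolding A mult_minus_right ab(2)[symmetric] by (simp add: algebra_simps)
  moreover have "(h1 - h3)\<^sup>2 + (h2 - h0)\<^sup>2 = int q"
    using assms unfolding period_data_def by (simp add: power2_commute)
  moreover have "(h1 + h3 - h2 - h0)\<^sup>2 = int q"
    unfolding A power2_minus using assms by (simp add: period_data_def)
  moreover have "h1 + h2 + h3 + h0 = - 1" using assms by (simp add: period_data_def)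
  ultimately show ?thesis using ab(3) unfolding period_data_def by blast
qed

lemma period_data_even:
  assumes "period_data p q h0 h1 h2 h3" "[h0 + h2 - h1 - h3 = 3] (mod 4)"
  shows "even (h1 - h3)"
proof -
  have "h0 + h1 + h2 + h3 = - 1"
    using assms(1) by (simp add: period_data_def)
  then have "2 * (h1 + h3) = - 1 - (h0 + h2 - h1 - h3)" by presburger
  moreover have "(h0 + h2 - h1 - h3) mod 4 = 3" using assms(2) by (simp add: cong_def)
  ultimately show ?thesis by presburger
qed

text \<open>One of the two differences is 0, because the sum of two squares is trivial. It is
  \<open>h1 - h3\<close>, since that difference is even while \<open>p\<close> is odd.\<close>

lemma period_data_3_mod_4:
  assumes data: "period_data p q h0 h1 h2 h3" and sgn: "[h0 + h2 - h1 - h3 = 3] (mod 4)"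
    and p: "prime p" "[p = 3] (mod 4)" and q: "q = (p ^ k)\<^sup>2"
  shows "h1 = h3 \<and> (h0 - h2 = int p ^ k \<or> h0 - h2 = - (int p ^ k))"
proof -
  have norm: "(h0 - h2)\<^sup>2 + (h1 - h3)\<^sup>2 = (int p ^ k)\<^sup>2"
    using data by (simp add: period_data_def q)
  have "odd p" using p(2) by (auto simp: cong_def) presburger
  have "h0 - h2 \<noteq> 0"
  proof
    assume "h0 - h2 = 0"
    then have "even ((int p ^ k)\<^sup>2)" using norm period_data_even[OF data sgn] by (simp flip: norm)
    then show False using \<open>odd p\<close> by simp
  qed
  then have Q: "h1 - h3 = 0" using sum_squares_prime_power_3_mod_4[OF p norm] by blast
  then have "(h0 - h2)\<^sup>2 = (int p ^ k)\<^sup>2" using norm by simp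
  then show ?thesis using Q by (auto simp only: power2_eq_iff)
qed

section \<open>The Gaussian periods\<close>

text \<open>Passing to integers hides \<open>\<psi>\<close> and \<open>\<iota>\<close>. The last
  conjunct is the criterion for strong regularity, comparing the index shifts 1 and 3 with the shift
  2.\<close>

lemma gaussian_periods:
  fixes vs :: "'a::{field,finite} list"
  assumes p: "prime p" and card: "CARD('a) = p ^ m" and q: "p ^ m = 4 * n + 1"
    and n: "even n" "n > 0" "(p - 1) dvd n" and vs: "distinct vs" "set vs = UNIV"
  shows "\<exists>h0 h1 h2 h3. period_data p (p ^ m) h0 h1 h2 h3 \<and>
    graph_spectrum vs (gen_paley 4) = {#of_nat n#} + replicate_mset n (of_int h0) +
      replicate_mset n (of_int h1) + replicate_mset n (of_int h2) + replicate_mset n (of_int h3) \<and>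
    (h0\<^sup>2 * h1 + h1\<^sup>2 * h2 + h2\<^sup>2 * h3 + h3\<^sup>2 * h0 = h0\<^sup>2 * h2 + h1\<^sup>2 * h3 + h2\<^sup>2 * h0 + h3\<^sup>2 * h1 \<and>
     h0\<^sup>2 * h3 + h1\<^sup>2 * h0 + h2\<^sup>2 * h1 + h3\<^sup>2 * h2 = h0\<^sup>2 * h2 + h1\<^sup>2 * h3 + h2\<^sup>2 * h0 + h3\<^sup>2 * h1 \<longrightarrow>
     strongly_regular (gen_paley 4 :: 'a pair_pre_digraph))"
proof -
  obtain \<psi> :: "'a \<Rightarrow> complex" where psi: "\<forall>x y. \<psi> (x + y) = \<psi> x * \<psi> y" "\<psi> 0 = 1" "\<exists>x. \<psi> x \<noteq> 1"
    and psi_int: "\<forall>C. (\<forall>k x. 0 < k \<and> k < p \<and> x \<in> C \<longrightarrow> of_nat k * x \<in> C) \<longrightarrow> (\<Sum>x\<in>C. \<psi> x) \<in> \<int>"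
    using ex_additive_character[OF p card] by blast
  obtain \<iota> :: 'a where iota: "\<iota>\<^sup>2 = - 1"
    using sqrt_minus_one_exists[where 'a = 'a, of n] card q n by auto
  interpret quartic_gauss n \<iota> \<psi>
    by unfold_locales (use psi iota card q n in auto)
  have "of_nat (p ^ m) = (0 :: 'a)"
    using of_nat_card_UNIV_eq_0[where 'a = 'a] card by simp
  then have "of_nat p = (0 :: 'a)" by simp
  then have "CHAR('a) dvd p" by (simp add: of_nat_eq_0_iff_char_dvd)
  moreover have "CHAR('a) \<noteq> 1" by (metis of_nat_CHAR of_nat_1 zero_neq_one)
  ultimately have char: "CHAR('a) = p" using p by (metis prime_nat_iff)
  \<comment> \<open>As \<open>p - 1\<close> divides \<open>n\<close>, Fermat makes the nonzero
    elements of the prime field fourth powers. Each class is then stable under multiplication by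
    them, so the periods are integers.\<close>
  have prime_field: "of_nat k \<in> cls 0" if "0 < k" "k < p" for k
  proof -
    have "\<not> p dvd k" using that by (auto dest: dvd_imp_le)
    then have "[k ^ (p - 1) = 1] (mod p)" by (rule fermat_little[OF p])
    then have 1: "of_nat k ^ (p - 1) = (1 :: 'a)"
      using of_nat_eq_iff_cong_CHAR[of "k ^ (p - 1)" 1, where 'a = 'a] char by simp
    obtain c where "n = (p - 1) * c" using n(3) by (rule dvdE)
    then have "of_nat k ^ n = (1 :: 'a)" by (simp only: power_mult 1 power_one)
    then show ?thesis by (simp add: cls_def)
  qed
  have "\<eta> j \<in> \<int>" for j
  proof -
    have "\<forall>k x. 0 < k \<and> k < p \<and> x \<in> cls j \<longrightarrow> of_nat k * x \<in> cls j"
      using prime_field cls_mult[of _ 0 _ j] by simp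
    then show ?thesis using psi_int by (simp add: \<eta>_def)
  qed
  then have "\<forall>j. \<exists>z :: int. \<eta> j = of_int z" by (metis Ints_cases)
  then obtain h :: "nat \<Rightarrow> int" where h: "\<And>j. \<eta> j = of_int (h j)" by metis
  have sum: "h 0 + h 1 + h 2 + h 3 = - 1"
  proof -
    have "of_int (h 0 + h 1 + h 2 + h 3) = (of_int (- 1) :: complex)"
      using sum_\<eta> by (simp add: h)
    then show ?thesis by (simp only: of_int_eq_iff)
  qed
  have quad: "(h 0 + h 2 - h 1 - h 3)\<^sup>2 = int (p ^ m)"
  proof -
    have "of_int ((h 0 + h 2 - h 1 - h 3)\<^sup>2) = (of_int (int (p ^ m)) :: complex)"
      using norm_quadratic by (simp add: h q)
    then show ?thesis by (simp only: of_int_eq_iff)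
  qed
  have norm: "(h 0 - h 2)\<^sup>2 + (h 1 - h 3)\<^sup>2 = int (p ^ m)"
  proof -
    have "of_int ((h 0 - h 2)\<^sup>2 + (h 1 - h 3)\<^sup>2) = (of_int (int (p ^ m)) :: complex)"
      using norm_quartic by (simp add: h q)
    then show ?thesis by (simp only: of_int_eq_iff)
  qed
  define a b where "a = jac 0 - jac 2" and "b = jac 1 - jac 3"
  define P Q A where "P = h 0 - h 2" and "Q = h 1 - h 3" and "A = h 0 + h 2 - h 1 - h 3"
  have "(of_int P + \<i> * of_int Q)\<^sup>2 = (of_int a + \<i> * of_int b) * (of_int A :: complex)"
    using quartic_square by (simp add: h a_def b_def P_def Q_def A_def)
  \<comment> \<open>Real and imaginary parts can be compared because all quantities are
    integers.\<close>
  then have "Complex (of_int (P\<^sup>2 - Q\<^sup>2)) (of_int (2 * P * Q)) = Complex (of_int (a * A)) (of_int (b * A))"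
    by (simp add: complex_eq_iff power2_eq_square)
  then have sq: "P\<^sup>2 - Q\<^sup>2 = a * A" "2 * P * Q = b * A"
    by (simp_all only: complex.inject of_int_eq_iff)
  have ndvd: "[p = 1] (mod 4) \<longrightarrow> \<not> (int p dvd a \<and> int p dvd b)"
  proof
    assume "[p = 1] (mod 4)"
    then have "p mod 4 = 1" by (simp add: cong_def)
    then have "p = 4 * (p div 4) + 1" by presburger
    then show "\<not> (int p dvd a \<and> int p dvd b)"
      unfolding a_def b_def by (rule jacobi_not_dvd[OF p _ q])
  qed
  have "period_data p (p ^ m) (h 0) (h 1) (h 2) (h 3)"
    unfolding period_data_def using sum quad norm sq ndvd unfolding P_def Q_def A_def by blast
  moreover have "graph_spectrum vs (gen_paley 4) = {#of_nat n#} + replicate_mset n (of_int (h 0)) +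
      replicate_mset n (of_int (h 1)) + replicate_mset n (of_int (h 2)) + replicate_mset n (of_int (h 3))"
    using graph_spectrum_gen_paley[OF vs] by (simp only: h)
  moreover
  let ?T = "(h 0)\<^sup>2 * h 2 + (h 1)\<^sup>2 * h 3 + (h 2)\<^sup>2 * h 0 + (h 3)\<^sup>2 * h 1"
  have "strongly_regular (gen_paley 4 :: 'a pair_pre_digraph)"
    if "(h 0)\<^sup>2 * h 1 + (h 1)\<^sup>2 * h 2 + (h 2)\<^sup>2 * h 3 + (h 3)\<^sup>2 * h 0 = ?T"
       "(h 0)\<^sup>2 * h 3 + (h 1)\<^sup>2 * h 0 + (h 2)\<^sup>2 * h 1 + (h 3)\<^sup>2 * h 2 = ?T"
  proof (rule strongly_regular_gen_paley)
    fix k :: nat assume "k \<in> {1, 2, 3}"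
    have per: "\<eta> 4 = \<eta> 0" "\<eta> 5 = \<eta> 1" "\<eta> 6 = \<eta> 2"
      using \<eta>_mod[of 4] \<eta>_mod[of 5] \<eta>_mod[of 6] by simp_all
    have "(\<Sum>j<4. (\<eta> j)\<^sup>2 * \<eta> (j + k)) =
        (\<eta> 0)\<^sup>2 * \<eta> k + (\<eta> 1)\<^sup>2 * \<eta> (1 + k) + (\<eta> 2)\<^sup>2 * \<eta> (2 + k) + (\<eta> 3)\<^sup>2 * \<eta> (3 + k)"
      by (simp add: eval_nat_numeral)
    also have "\<dots> = of_int ?T"
    proof -
      consider "k = 1" | "k = 2" | "k = 3" using \<open>k \<in> {1, 2, 3}\<close> by blast
      then show ?thesis
      proof cases
        case 1
        have "(\<eta> 0)\<^sup>2 * \<eta> k + (\<eta> 1)\<^sup>2 * \<eta> (1 + k) + (\<eta> 2)\<^sup>2 * \<eta> (2 + k) + (\<eta> 3)\<^sup>2 * \<eta> (3 + k) =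
            of_int ((h 0)\<^sup>2 * h 1 + (h 1)\<^sup>2 * h 2 + (h 2)\<^sup>2 * h 3 + (h 3)\<^sup>2 * h 0)"
          using per by (simp add: 1 h del: One_nat_def)
        then show ?thesis by (simp only: that(1))
      next
        case 2
        then show ?thesis using per by (simp add: h del: One_nat_def)
      next
        case 3
        have "(\<eta> 0)\<^sup>2 * \<eta> k + (\<eta> 1)\<^sup>2 * \<eta> (1 + k) + (\<eta> 2)\<^sup>2 * \<eta> (2 + k) + (\<eta> 3)\<^sup>2 * \<eta> (3 + k) =
            of_int ((h 0)\<^sup>2 * h 3 + (h 1)\<^sup>2 * h 0 + (h 2)\<^sup>2 * h 1 + (h 3)\<^sup>2 * h 2)"
          using per by (simp add: 3 h del: One_nat_def)
        then show ?thesis by (simp only: that(2))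
      qed
    qed
    finally show "(\<Sum>j<4. (\<eta> j)\<^sup>2 * \<eta> (j + k)) = of_int ?T" .
  qed
  ultimately show ?thesis by blast
qed

text \<open>
  Up to a cyclic shift of the periods, the quadratic Gauss sum is the square root of \<open>q\<close> that is
  congruent to \<open>3\<close> modulo \<open>4\<close>.
\<close>

lemma normalized_gaussian_periods:
  fixes vs :: "'a::{field,finite} list"
  assumes p: "prime p" and card: "CARD('a) = p ^ m" and q: "p ^ m = 4 * n + 1"
    and n: "even n" "n > 0" "(p - 1) dvd n" and vs: "distinct vs" "set vs = UNIV"
  shows "\<exists>h0 h1 h2 h3. period_data p (p ^ m) h0 h1 h2 h3 \<and> [h0 + h2 - h1 - h3 = 3] (mod 4) \<and>
    graph_spectrum vs (gen_paley 4) = {#of_nat n#} + replicate_mset n (of_int h0) +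
      replicate_mset n (of_int h1) + replicate_mset n (of_int h2) + replicate_mset n (of_int h3) \<and>
    (h1 = h3 \<and> (h0 = h1 \<or> h2 = h1) \<longrightarrow> strongly_regular (gen_paley 4 :: 'a pair_pre_digraph))"
proof -
  obtain h0 h1 h2 h3 where data: "period_data p (p ^ m) h0 h1 h2 h3" and
    spec: "graph_spectrum vs (gen_paley 4) = {#of_nat n#} + replicate_mset n (of_int h0) +
      replicate_mset n (of_int h1) + replicate_mset n (of_int h2) + replicate_mset n (of_int h3)" and
    srg: "h0\<^sup>2 * h1 + h1\<^sup>2 * h2 + h2\<^sup>2 * h3 + h3\<^sup>2 * h0 = h0\<^sup>2 * h2 + h1\<^sup>2 * h3 + h2\<^sup>2 * h0 + h3\<^sup>2 * h1 \<and>
     h0\<^sup>2 * h3 + h1\<^sup>2 * h0 + h2\<^sup>2 * h1 + h3\<^sup>2 * h2 = h0\<^sup>2 * h2 + h1\<^sup>2 * h3 + h2\<^sup>2 * h0 + h3\<^sup>2 * h1 \<longrightarrow>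
     strongly_regular (gen_paley 4 :: 'a pair_pre_digraph)"
    using gaussian_periods[OF assms] by blast
  have "odd ((h0 + h2 - h1 - h3)\<^sup>2)"
    using data q by (simp add: period_data_def)
  then have "odd (h0 + h2 - h1 - h3)" by simp
  then have "(h0 + h2 - h1 - h3) mod 4 = 3 \<or> (h1 + h3 - h2 - h0) mod 4 = 3" by presburger
  then consider "(h0 + h2 - h1 - h3) mod 4 = 3" | "(h1 + h3 - h2 - h0) mod 4 = 3" by blast
  then show ?thesis
  proof cases
    case 1
    then have "[h0 + h2 - h1 - h3 = 3] (mod 4)" by (simp add: cong_def)
    moreover have "h1 = h3 \<and> (h0 = h1 \<or> h2 = h1) \<longrightarrow> strongly_regular (gen_paley 4 :: 'a pair_pre_digraph)"
    proof
      assume "h1 = h3 \<and> (h0 = h1 \<or> h2 = h1)"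
      then show "strongly_regular (gen_paley 4 :: 'a pair_pre_digraph)"
        by (intro srg[rule_format]) (elim conjE disjE; simp)
    qed
    ultimately show ?thesis using data spec by blast
  next
    case 2
    then have "[h1 + h3 - h2 - h0 = 3] (mod 4)" by (simp add: cong_def)
    moreover have "h2 = h0 \<and> (h1 = h2 \<or> h3 = h2) \<longrightarrow> strongly_regular (gen_paley 4 :: 'a pair_pre_digraph)"
    proof
      assume "h2 = h0 \<and> (h1 = h2 \<or> h3 = h2)"
      then show "strongly_regular (gen_paley 4 :: 'a pair_pre_digraph)"
        by (intro srg[rule_format]) (elim conjE disjE; simp)
    qed
    moreover have "graph_spectrum vs (gen_paley 4) = {#of_nat n#} + replicate_mset n (of_int h1) +
      replicate_mset n (of_int h2) + replicate_mset n (of_int h3) + replicate_mset n (of_int h0)"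
      using spec by (simp only: add_ac)
    ultimately show ?thesis using period_data_shift[OF data] by blast
  qed
qed

theorem theorem2p4:
  fixes p m q n :: nat
    and vs :: "'a::{field,finite} list"
  assumes "prime p"
    and "q = p ^ m"
    and "CARD('a) = q"
    and "q \<ge> 5" and "q \<noteq> 9"
    and "4 dvd (q - 1) div (p - 1)"
    and "n = (q - 1) div 4"
    and "distinct vs" and "set vs = UNIV"
  shows "connected (with_proj (gen_paley 4 :: 'a pair_pre_digraph))
    \<and> (\<forall>x. eigenvalue (adjacency_matrix vs (gen_paley 4)) x \<longrightarrow> x \<in> \<int>)
    \<and> ([p = 1] (mod 4) \<longrightarrow>
         (\<exists>t. m = 4 * t)
       \<and> (\<exists>c d. paley4_rep p q c d)
       \<and> (\<forall>c d c' d'. paley4_rep p q c d \<and> paley4_rep p q c' d' \<longrightarrow>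
            c' = c \<and> (d' = d \<or> d' = - d))
       \<and> (\<forall>c d. paley4_rep p q c d \<longrightarrow>
            graph_spectrum vs (gen_paley 4) = image_mset complex_of_real
              ({#real n#}
               + replicate_mset n ((sqrt q + 4 * real_of_int d * root 4 q - 1) / 4)
               + replicate_mset n ((sqrt q - 4 * real_of_int d * root 4 q - 1) / 4)
               + replicate_mset n ((- sqrt q + 2 * real_of_int c * root 4 q - 1) / 4)
               + replicate_mset n ((- sqrt q - 2 * real_of_int c * root 4 q - 1) / 4))))
    \<and> ([p = 3] (mod 4) \<longrightarrow>
         (\<exists>t. m = 2 * t)
       \<and> (m mod 4 = 0 \<longrightarrow>
            graph_spectrum vs (gen_paley 4) = image_mset complex_of_real
              ({#real n#}
               + replicate_mset (3 * n) ((sqrt q - 1) / 4)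
               + replicate_mset n ((- 3 * sqrt q - 1) / 4)))
       \<and> (m mod 4 = 2 \<longrightarrow>
            graph_spectrum vs (gen_paley 4) = image_mset complex_of_real
              ({#real n#}
               + replicate_mset n ((3 * sqrt q - 1) / 4)
               + replicate_mset (3 * n) ((- sqrt q - 1) / 4)))
       \<and> strongly_regular (gen_paley 4 :: 'a pair_pre_digraph))"
proof -
  note p = assms(1) and q = assms(2) and card = assms(3) and vs = assms(8,9)
  \<comment> \<open>\<open>M\<close> is the geometric sum equal to
    \<open>(q - 1) div (p - 1)\<close>.\<close>
  define M where "M = (\<Sum>i<m. p ^ i)"
  have p2: "p \<ge> 2" using p by (rule prime_ge_2_nat)
  have "(p - 1) * (\<Sum>i<k. p ^ i) + 1 = p ^ k" for k
  proof (induction k)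
    case (Suc k)
    have "(p - 1) * (\<Sum>i<Suc k. p ^ i) + 1 = ((p - 1) * (\<Sum>i<k. p ^ i) + 1) + (p - 1) * p ^ k"
      by (simp add: distrib_left)
    also have "\<dots> = (1 + (p - 1)) * p ^ k" by (simp only: Suc distrib_right mult_1)
    also have "\<dots> = p ^ Suc k" using p2 by simp
    finally show ?case .
  qed simp
  from this[of m] have qM: "q = (p - 1) * M + 1" by (simp add: M_def q)
  then have "(q - 1) div (p - 1) = M" using p2 by simp
  then have "4 dvd M" using assms(6) by simp
  then obtain M' where M': "M = 4 * M'" by (rule dvdE)
  \<comment> \<open>The second equation gives both that \<open>p - 1\<close> divides
    \<open>n\<close> and, once \<open>p\<close> is known to be odd, that \<open>n\<close> is
    even.\<close>
  have q4: "q = 4 * n + 1" and nM: "n = (p - 1) * M'"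
    using qM assms(7) by (simp_all add: M')
  have "odd p"
  proof
    assume "even p"
    then have "even q" using q assms(4) by (cases m) auto
    then show False unfolding q4 by simp
  qed
  \<comment> \<open>Every summand \<open>p ^ i\<close> is 1 modulo \<open>k\<close>. Modulo 2 this
    makes \<open>m\<close> even; modulo 4 it yields \<open>4 dvd m\<close> in case (a).\<close>
  have M_m: "[M = m] (mod k)" if "[p = 1] (mod k)" for k
  proof -
    have "[(\<Sum>i<m. p ^ i) = (\<Sum>i<m. 1)] (mod k)"
      by (rule cong_sum) (use cong_pow[OF that] in simp)
    then show ?thesis by (simp add: M_def)
  qed
  have "[p = 1] (mod 2)" using \<open>odd p\<close> by (simp add: cong_def odd_iff_mod_2_eq_one)
  then have "[M = m] (mod 2)" by (rule M_m)
  then have "M mod 2 = m mod 2" by (simp only: cong_def)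
  then have "even m" using M' by presburger
  then obtain k where mk: "m = 2 * k" by (rule evenE)
  define s where "s = p ^ k"
  have qs: "q = s\<^sup>2" by (simp add: q mk s_def mult.commute flip: power_mult)
  have sqrt_q: "sqrt (real q) = real s" by (simp add: qs)
  have n_even: "even n" using nM \<open>odd p\<close> p2 by simp
  have n0: "n > 0" using q4 assms(4) by simp
  \<comment> \<open>The value 2 is excluded by \<open>q \<noteq> 9\<close>, the value 1 by
    parity.\<close>
  have n2: "n > 2"
  proof -
    have "n \<noteq> 2" using q4 assms(5) by auto
    moreover have "n \<noteq> 1" using n_even by auto
    ultimately show ?thesis using n0 by simp
  qed
  have pn: "(p - 1) dvd n" using nM by simp
  have card': "CARD('a) = p ^ m" and q4': "p ^ m = 4 * n + 1" using card q q4 by simp_all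
  obtain \<iota> :: 'a where iota: "\<iota>\<^sup>2 = - 1"
    using sqrt_minus_one_exists[where 'a = 'a, of n] card q4 n0 by auto
  interpret quartic_field n \<iota>
    by unfold_locales (use iota card q4 n_even n0 in auto)
  have conn: "connected (with_proj (gen_paley 4 :: 'a pair_pre_digraph))"
    by (rule connected_gen_paley[OF n2])
  obtain h0 h1 h2 h3 where data: "period_data p (p ^ m) h0 h1 h2 h3" and
    sgn: "[h0 + h2 - h1 - h3 = 3] (mod 4)" and
    spec: "graph_spectrum vs (gen_paley 4) = {#of_nat n#} + replicate_mset n (of_int h0) +
      replicate_mset n (of_int h1) + replicate_mset n (of_int h2) + replicate_mset n (of_int h3)" and
    srg: "h1 = h3 \<and> (h0 = h1 \<or> h2 = h1) \<longrightarrow> strongly_regular (gen_paley 4 :: 'a pair_pre_digraph)"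
    using normalized_gaussian_periods[OF p card' q4' n_even n0 pn vs] by blast
  define P Q A where "P = h0 - h2" and "Q = h1 - h3" and "A = h0 + h2 - h1 - h3"
  have sum: "h0 + h1 + h2 + h3 = - 1" using data by (simp add: period_data_def)
  \<comment> \<open>The sum of the periods together with \<open>A\<close>, \<open>P\<close> and
    \<open>Q\<close> determines them linearly.\<close>
  then have h: "4 * h0 = A + 2 * P - 1" "4 * h2 = A - 2 * P - 1"
    "4 * h1 = - A + 2 * Q - 1" "4 * h3 = - A - 2 * Q - 1"
    unfolding A_def P_def Q_def by presburger+
  have "A\<^sup>2 = (int s)\<^sup>2"
    using data qs q unfolding A_def by (simp add: period_data_def flip: of_nat_power)
  then have A_cases: "A = int s \<or> A = - int s" by (simp add: power2_eq_iff)
  have A_mod: "A mod 4 = 3" using sgn by (simp add: A_def cong_def)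
  have integral: "x \<in> \<int>" if "eigenvalue (adjacency_matrix vs (gen_paley 4)) x" for x
  proof -
    let ?B = "adjacency_matrix vs (gen_paley 4 :: 'a pair_pre_digraph)"
    have B: "?B \<in> carrier_mat (length vs) (length vs)" by (simp add: adjacency_matrix_def)
    have "poly (char_poly ?B) x = 0" using that eigenvalue_root_char_poly[OF B] by simp
    moreover have "char_poly ?B \<noteq> 0" using degree_monic_char_poly[OF B] by auto
    ultimately have "x \<in># graph_spectrum vs (gen_paley 4)"
      unfolding graph_spectrum_def by (simp add: set_count_proots)
    then show ?thesis using spec by (auto split: if_splits)
  qed
  have case_a: "(\<exists>t. m = 4 * t) \<and> (\<exists>c d. paley4_rep p q c d)
       \<and> (\<forall>c d c' d'. paley4_rep p q c d \<and> paley4_rep p q c' d' \<longrightarrow>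
            c' = c \<and> (d' = d \<or> d' = - d))
       \<and> (\<forall>c d. paley4_rep p q c d \<longrightarrow>
            graph_spectrum vs (gen_paley 4) = image_mset complex_of_real
              ({#real n#}
               + replicate_mset n ((sqrt q + 4 * real_of_int d * root 4 q - 1) / 4)
               + replicate_mset n ((sqrt q - 4 * real_of_int d * root 4 q - 1) / 4)
               + replicate_mset n ((- sqrt q + 2 * real_of_int c * root 4 q - 1) / 4)
               + replicate_mset n ((- sqrt q - 2 * real_of_int c * root 4 q - 1) / 4)))"
    if p1: "[p = 1] (mod 4)"
  proof -
    have "[4 * M' = m] (mod 4)" using M_m[OF p1] M' by simp
    then have "4 dvd m" by (simp add: cong_def mod_eq_0_iff_dvd)
    then obtain t where mt: "m = 4 * t" by (rule dvdE)
    then have kt: "k = 2 * t" using mk by simp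
    have t0: "t > 0" using assms(4) q mt by (cases t) auto
    have ip: "prime (int p)" using p by simp
    have s_eq: "s = p ^ (2 * t)" by (simp add: s_def kt)
    have root_q: "root 4 (real q) = real (p ^ t)"
    proof -
      have "real q = real (p ^ t) ^ 4" by (simp add: q mt mult.commute flip: power_mult)
      then show ?thesis by (simp add: real_root_power_cancel)
    qed
    have rep_iff: "paley4_rep p q c d \<longleftrightarrow>
        c\<^sup>2 + 4 * d\<^sup>2 = int p ^ (2 * t) \<and> [c = 1] (mod 4) \<and> \<not> int p dvd c" for c d
    proof -
      have "real s = real_of_int (int p ^ (2 * t))" by (simp add: s_eq)
      then have "sqrt (real q) = real_of_int (c\<^sup>2 + 4 * d\<^sup>2) \<longleftrightarrow> int p ^ (2 * t) = c\<^sup>2 + 4 * d\<^sup>2"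
        by (simp only: sqrt_q of_int_eq_iff)
      moreover have "gcd c (int p) = 1 \<longleftrightarrow> \<not> int p dvd c"
        using ip by (metis coprime_iff_gcd_eq_1 coprime_commute prime_imp_coprime
            coprime_absorb_left not_prime_unit)
      ultimately show ?thesis unfolding paley4_rep_def by auto
    qed
    have s1: "s mod 4 = 1"
    proof -
      have "[p ^ (2 * t) = 1 ^ (2 * t)] (mod 4)" by (rule cong_pow[OF p1])
      then show ?thesis by (simp add: s_eq cong_def)
    qed
    \<comment> \<open>Here \<open>s\<close> is 1 modulo 4, so only the negative square root of
      \<open>q\<close> is 3 modulo 4.\<close>
    have A: "A = - int s"
    proof -
      have "int s mod 4 = 1" using s1 by (metis of_nat_1 of_nat_mod of_nat_numeral)
      then show ?thesis using A_cases A_mod by auto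
    qed
    obtain a b where ab: "P\<^sup>2 - Q\<^sup>2 = a * A" "2 * P * Q = b * A" "\<not> (int p dvd a \<and> int p dvd b)"
      using data p1 unfolding period_data_def P_def Q_def A_def by blast
    have "P\<^sup>2 + Q\<^sup>2 = int p ^ (4 * t)"
      using data by (simp add: period_data_def P_def Q_def mt)
    moreover have "P\<^sup>2 - Q\<^sup>2 = (- a) * int p ^ (2 * t)" "2 * P * Q = (- b) * int p ^ (2 * t)"
      using ab(1,2) by (simp_all add: A s_eq)
    moreover have "\<not> (int p dvd - a \<and> int p dvd - b)" using ab(3) by simp
    moreover have "even Q" using period_data_even[OF data sgn] by (simp add: Q_def)
    ultimately obtain c d where cd: "[c = 1] (mod 4)" "\<not> int p dvd c" "c\<^sup>2 + 4 * d\<^sup>2 = int p ^ (2 * t)"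
        "P = int p ^ t * c \<or> P = - (int p ^ t * c)" "Q = 2 * (int p ^ t * d)"
      using gauss_sum_exact_power[OF ip \<open>odd p\<close> t0, of P Q "- a" "- b"] by blast
    have unique: "c' = c \<and> (d' = d \<or> d' = - d)" if "paley4_rep p q c d" "paley4_rep p q c' d'" for c d c' d'
      by (rule primitive_rep_unique[OF ip \<open>odd p\<close> refl, of "2 * t"]) (use that t0 in \<open>simp_all add: rep_iff\<close>)
    have rep: "paley4_rep p q c d" using cd by (simp add: rep_iff)
    define r where "r = real (p ^ t)"
    have real_h: "real_of_int h0 = (- real s + 2 * real_of_int P - 1) / 4"
        "real_of_int h2 = (- real s - 2 * real_of_int P - 1) / 4"
        "real_of_int h1 = (real s + 2 * real_of_int Q - 1) / 4"
        "real_of_int h3 = (real s - 2 * real_of_int Q - 1) / 4"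
      using h[THEN arg_cong[of _ _ real_of_int]] by (simp_all add: A)
    have PQ: "real_of_int P = r * c \<or> real_of_int P = - (r * c)" "real_of_int Q = 2 * (r * d)"
      using cd(4,5) by (auto simp: r_def)
    have spectrum: "graph_spectrum vs (gen_paley 4) = image_mset complex_of_real
              ({#real n#}
               + replicate_mset n ((sqrt q + 4 * real_of_int d' * root 4 q - 1) / 4)
               + replicate_mset n ((sqrt q - 4 * real_of_int d' * root 4 q - 1) / 4)
               + replicate_mset n ((- sqrt q + 2 * real_of_int c' * root 4 q - 1) / 4)
               + replicate_mset n ((- sqrt q - 2 * real_of_int c' * root 4 q - 1) / 4))"
      (is "_ = image_mset _ (_ + ?D1 + ?D2 + ?C1 + ?C2)")
      if "paley4_rep p q c' d'" for c' d'
    proof -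
      have c': "c' = c" "d' = d \<or> d' = - d" using unique[OF rep that] by auto
      have uc: "2 * real_of_int c' * root 4 q = 2 * (r * c)"
        unfolding root_q r_def[symmetric] c'(1) by simp
      \<comment> \<open>The sign of \<open>P\<close> only exchanges \<open>h0\<close> and
        \<open>h2\<close>, and the sign of \<open>d'\<close> only exchanges \<open>?D1\<close> and
        \<open>?D2\<close>; neither affects the multiset.\<close>
      have "real_of_int h0 = (- real s + 2 * (r * c) - 1) / 4 \<and>
              real_of_int h2 = (- real s - 2 * (r * c) - 1) / 4 \<or>
            real_of_int h0 = (- real s - 2 * (r * c) - 1) / 4 \<and>
              real_of_int h2 = (- real s + 2 * (r * c) - 1) / 4"
        using PQ(1) real_h(1,2) by auto
      then have "?C1 + ?C2 = replicate_mset n (real_of_int h0) + replicate_mset n (real_of_int h2)"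
        unfolding uc sqrt_q by (elim disjE conjE) (simp_all only: add.commute)
      moreover have ud: "4 * real_of_int d' * root 4 q = 4 * (r * d) \<or>
          4 * real_of_int d' * root 4 q = - (4 * (r * d))"
        unfolding root_q r_def[symmetric] using c'(2) by auto
      have "real_of_int h1 = (real s + 4 * (r * d) - 1) / 4 \<and>
          real_of_int h3 = (real s - 4 * (r * d) - 1) / 4"
        using PQ(2) real_h(3,4) by simp
      with ud have "?D1 + ?D2 = replicate_mset n (real_of_int h1) + replicate_mset n (real_of_int h3)"
        unfolding sqrt_q by (elim disjE conjE) (simp_all only: minus_minus diff_minus_eq_add
            add_uminus_conv_diff add.commute)
      moreover have "graph_spectrum vs (gen_paley 4) = image_mset complex_of_real ({#real n#} +
          (replicate_mset n (real_of_int h1) + replicate_mset n (real_of_int h3)) +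
          (replicate_mset n (real_of_int h0) + replicate_mset n (real_of_int h2)))"
        unfolding spec by (simp add: add_ac)
      ultimately show ?thesis by (simp only: add.assoc)
    qed
    show ?thesis using mt rep unique spectrum by blast
  qed
  have case_b: "(\<exists>t. m = 2 * t)
       \<and> (m mod 4 = 0 \<longrightarrow>
            graph_spectrum vs (gen_paley 4) = image_mset complex_of_real
              ({#real n#}
               + replicate_mset (3 * n) ((sqrt q - 1) / 4)
               + replicate_mset n ((- 3 * sqrt q - 1) / 4)))
       \<and> (m mod 4 = 2 \<longrightarrow>
            graph_spectrum vs (gen_paley 4) = image_mset complex_of_real
              ({#real n#}
               + replicate_mset n ((3 * sqrt q - 1) / 4)
               + replicate_mset (3 * n) ((- sqrt q - 1) / 4)))
       \<and> strongly_regular (gen_paley 4 :: 'a pair_pre_digraph)"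
    if p3: "[p = 3] (mod 4)"
  proof -
    have pq: "p ^ m = (p ^ k)\<^sup>2" using q qs s_def by simp
    have h13: "h1 = h3" and P: "P = int s \<or> P = - int s"
      using period_data_3_mod_4[OF data sgn p p3 pq] by (auto simp: P_def s_def)
    then have Q0: "Q = 0" by (simp add: Q_def)
    \<comment> \<open>Both \<open>P\<close> and \<open>A\<close> are \<open>s\<close> up to sign:
      \<open>P = - A\<close> gives \<open>h0 = h1\<close>, and \<open>P = A\<close> gives
      \<open>h2 = h1\<close>.\<close>
    have "h0 = h1 \<or> h2 = h1" using h A_cases P Q0 by auto
    then have SRG: "strongly_regular (gen_paley 4 :: 'a pair_pre_digraph)" using srg h13 by blast
    have p_mod: "int p mod 4 = 3"
      using p3 by (simp add: cong_def) (metis of_nat_mod of_nat_numeral)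
    \<comment> \<open>Since \<open>A\<close> is 3 modulo 4, the parity of \<open>k\<close>, that is
      \<open>m mod 4\<close>, decides the sign of \<open>A\<close> and hence which of the two
      spectra occurs.\<close>
    have s_mod: "int s mod 4 = (if even k then 1 else 3)"
    proof -
      have "[int p = - 1] (mod 4)" using p_mod by (simp add: cong_def)
      then have "[int p ^ k = (- 1) ^ k] (mod 4)" by (rule cong_pow)
      then show ?thesis by (auto simp: s_def cong_def)
    qed
    have spec': "graph_spectrum vs (gen_paley 4) = image_mset complex_of_real ({#real n#} +
        (replicate_mset n (real_of_int h1) + replicate_mset n (real_of_int h1)) +
        (replicate_mset n (real_of_int h0) + replicate_mset n (real_of_int h2)))"
      unfolding spec h13 by (simp add: add_ac)
    have rep3: "replicate_mset (3 * n) x = replicate_mset n x + replicate_mset n x + replicate_mset n x" for x :: real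
      by (rule multiset_eqI) simp
    have real_h: "real_of_int h0 = (real_of_int A + 2 * real_of_int P - 1) / 4"
        "real_of_int h2 = (real_of_int A - 2 * real_of_int P - 1) / 4"
        "real_of_int h1 = (- real_of_int A - 1) / 4"
      using h[THEN arg_cong[of _ _ real_of_int]] by (simp_all add: Q0)
    have "graph_spectrum vs (gen_paley 4) = image_mset complex_of_real
              ({#real n#} + replicate_mset (3 * n) ((sqrt q - 1) / 4)
               + replicate_mset n ((- 3 * sqrt q - 1) / 4))" if "m mod 4 = 0"
    proof -
      have "even k" using that mk by presburger
      then have "A = - int s" using s_mod A_cases A_mod by auto
      then show ?thesis unfolding spec' rep3 real_h sqrt_q using P by (auto simp: add_ac)
    qed
    moreover have "graph_spectrum vs (gen_paley 4) = image_mset complex_of_real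
              ({#real n#} + replicate_mset n ((3 * sqrt q - 1) / 4)
               + replicate_mset (3 * n) ((- sqrt q - 1) / 4))" if "m mod 4 = 2"
    proof -
      have "odd k" using that mk by presburger
      have "A = int s"
      proof (rule ccontr)
        assume "A \<noteq> int s"
        then have "A = - int s" using A_cases by simp
        moreover have "int s mod 4 = 3" using s_mod \<open>odd k\<close> by simp
        ultimately show False using A_mod by presburger
      qed
      then show ?thesis unfolding spec' rep3 real_h sqrt_q using P by (auto simp: add_ac)
    qed
    ultimately show ?thesis using mk SRG by blast
  qed
  show ?thesis using conn integral case_a case_b by blast
qed

end
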